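(* Let $A$ be a vector space with binary operations $\cdot,\nearrow,\searrow,\nwarrow$ and $\swarrow$. Let $R(A)=\mathbf k[\partial]A$ and let $[\cdot_\lambda\cdot]$, $\lhd_\lambda$, $\rhd_\lambda$ be defined for $a,b\in A$ by $$[a_\lambda b]=\partial(b\cdot a)+\lambda(a\cdot b+b\cdot a),\quad a\lhd_\lambda b=\partial(b\searrow a)+\lambda(a\nwarrow b+b\searrow a),\quad a\rhd_\lambda b=\partial(b\nearrow a)+\lambda(a\swarrow b+b\nearrow a).$$ Then $(R(A),[\cdot_\lambda\cdot],\lhd_\lambda,\rhd_\lambda)$ is a partial-pre-post-Lie conformal algebra if and only if $(A,\cdot,\nearrow,\searrow,\nwarrow,\swarrow)$ is a partial-pre-post-Novikov algebra. In addition, $(R(A),[\cdot_\lambda\cdot],\lhd_\lambda,\rhd_\lambda)$ is special if and only if $(A,\cdot,\nearrow,\searrow,\nwarrow,\swarrow)$ is special. ($(R(A),[\cdot_\lambda\cdot],\lhd_\lambda,\rhd_\lambda)$ is called the partial-pre-post-Lie conformal algebra corresponding to the partial-pre-post-Novikov algebra $(A,\cdot,\nearrow,\searrow,\nwarrow,\swarrow)$.)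
   Context: $\mathbf k$ is a field of characteristic zero; vector spaces are finite-dimensional. $R(A)=\mathbf k[\partial]\otimes A$, and $\lambda$-products defined on $A$ are extended to $R(A)$ by conformal sesquilinearity: $(\partial a)\ast_\lambda b=-\lambda\,a\ast_\lambda b$, $a\ast_\lambda(\partial b)=(\lambda+\partial)(a\ast_\lambda b)$. Subscripts containing $\partial$ mean that the variable is replaced by the operator acting from the left on the coefficients. A Lie conformal algebra is a $\mathbf k[\partial]$-module $\mathcal A$ with a conformally sesquilinear $\mathbf k$-bilinear $[\cdot_\lambda\cdot]:\mathcal A\times\mathcal A\to\mathcal A[\lambda]$ with $[a_\lambda b]=-[b_{-\lambda-\partial}a]$ and $[a_\lambda[b_\mu c]]=[[a_\lambda b]_{\lambda+\mu}c]+[b_\mu[a_\lambda c]]$. A partial-pre-post-Lie conformal algebra $(\mathcal A,[\cdot_\lambda\cdot],\lhd_\lambda,\rhd_\lambda)$ is a Lie conformal algebra with two conformally sesquilinear products such that for all $a,b,c$: 1. $a\lhd_\lambda[b_\mu c]=[a_\lambda b]\lhd_{\lambda+\mu}c-[a_\lambda c]\lhd_{-\mu-\partial}b$; 2. $[a_\lambda(b\lhd_\mu c+c\lhd_{-\mu-\partial}b)]=[a_\lambda c]\lhd_{-\mu-\partial}b+b\lhd_\mu[a_\lambda c]$; 3. $a\rhd_\lambda[b_\mu c]-[b_\mu c]\lhd_{-\lambda-\partial}a=[(a\rhd_\lambda b+a\lhd_\lambda b)_{\lambda+\mu}c]+[b_\mu(a\rhd_\lambda c-c\lhd_{-\lambda-\partial}a)]$;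 4. $\{a_\lambda b\}\rhd_{\lambda+\mu}c=a\rhd_\lambda(b\rhd_\mu c)-b\rhd_\mu(a\rhd_\lambda c)+[b_\mu(a\lhd_\lambda c)]-[a_\lambda(b\lhd_\mu c)]-[a_\lambda b]\lhd_{\lambda+\mu}c$; 5. $(a\rhd_\lambda b-b\lhd_\mu a)\lhd_{\lambda+\mu}c+b\lhd_\mu(a\rhd_\lambda c+a\lhd_\lambda c)=a\rhd_\lambda(b\lhd_\mu c)+[a_\lambda(b\lhd_\mu c)]$; where $\{a_\lambda b\}=a\rhd_\lambda b+a\lhd_\lambda b-b\rhd_{-\lambda-\partial}a-b\lhd_{-\lambda-\partial}a+[a_\lambda b]$. It is special if $a\lhd_\lambda b=-b\lhd_{-\lambda-\partial}a$ for all $a,b$. A Novikov algebra $(A,\cdot)$ satisfies $(a\cdot b)\cdot c-a\cdot(b\cdot c)=(b\cdot a)\cdot c-b\cdot(a\cdot c)$ and $(a\cdot b)\cdot c=(a\cdot c)\cdot b$. A partial-pre-post-Novikov algebra $(A,\cdot,\nearrow,\searrow,\nwarrow,\swarrow)$ is a Novikov algebra $(A,\cdot)$ with four further binary operations such that, with $a\star b=a\nwarrow b+a\nearrow b+a\swarrow b+a\searrow b+a\cdot b$, for all $a,b,c\in A$: (1) $(c\nwarrow b+c\nearrow b)\cdot a=(c\cdot a)\nwarrow b+(c\cdot a)\nearrow b$; (2) $a\cdot(c\nearrow b+c\nwarrow b)+(c\nearrow b+c\nwarrow b)\cdot a=(a\nearrow b+a\searrow b)\cdot c+c\cdot(a\nearrow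 b+a\searrow b)$; (3) $(a\cdot b)\searrow c+c\nwarrow(a\cdot b)=a\searrow(c\cdot b)+(c\cdot b)\nwarrow a$; (4) $(c\cdot b)\nwarrow a=(c\cdot a)\nwarrow b=(c\cdot b)\searrow a$; (5) $(a\nwarrow b+a\swarrow b)\cdot c+c\cdot(a\nwarrow b+a\swarrow b)=a\swarrow(c\cdot b)+a\searrow(c\cdot b)+(c\cdot b)\nwarrow a+(c\cdot b)\nearrow a$; (6) $a\searrow(b\cdot c)+(b\cdot c)\nwarrow a=b\searrow(a\cdot c)+(a\cdot c)\nwarrow b$; (7) $(a\nwarrow b-a\searrow b)\cdot c=c\cdot(a\searrow b-a\nwarrow b)=0$; (8) $(a\swarrow c+a\searrow c)\cdot b=(a\nwarrow b+a\swarrow b)\cdot c$; (9) $(a\nwarrow b+a\swarrow b)\searrow c+c\nwarrow(a\nwarrow b+a\swarrow b)=a\cdot(c\nwarrow b)+(c\nwarrow b)\cdot a+a\swarrow(c\nwarrow b)+(c\nwarrow b)\nearrow a$; (10) $a\swarrow(c\nearrow b)+(c\nearrow b)\nearrow a+(a\searrow c)\cdot b=c\nearrow(a\star b)+c\nwarrow(a\cdot b)+a\cdot(c\nwarrow b)+(c\nwarrow b)\cdot a+(a\swarrow c)\nearrow b$; (11) $(a\nwarrow b+a\nearrow b)\nwarrow c=(a\nwarrow c)\nearrow b+(a\nwarrow c)\cdot b$; (12) $(a\star b)\swarrow c+(a\searrow c)\cdot b+(a\cdot b)\searrow c=(a\swarrow c)\nearrow b$; (13) $a\swarrow(c\searrow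 b)+(c\searrow b)\nearrow a+a\cdot(c\searrow b)+(c\searrow b)\cdot a=c\searrow(a\swarrow b+a\searrow b)+(a\swarrow b+a\searrow b)\nwarrow c$; (14) $(c\nearrow a+c\searrow a)\searrow b=(c\searrow b)\nearrow a+(c\searrow b)\cdot a$; (15) $a\swarrow(b\swarrow c)+(b\swarrow c)\nearrow a+b\cdot(a\swarrow c)+(a\swarrow c)\cdot b=b\swarrow(a\searrow c)+(a\swarrow c)\nearrow b+a\cdot(b\swarrow c)+(b\swarrow c)\cdot a$; (16) $(a\nwarrow b+a\swarrow b)\searrow c=(a\swarrow c+a\searrow c)\nwarrow b$; (17) $(a\nearrow b+a\searrow b)\searrow c+c\nwarrow(a\nearrow b+a\searrow b)=a\searrow(c\nearrow b+c\nwarrow b)+(c\nearrow b+c\nwarrow b)\nwarrow a$; (18) $(a\nearrow b)\nearrow c+(a\searrow c)\cdot b=(a\nearrow c)\nearrow b+(a\searrow b)\cdot c$. It is special if $a\searrow b=a\nwarrow b$ for all $a,b\in A$.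
   Formalization: Identity (15) is corrected to a↙(b↙c)+(b↙c)↗a+b·(a↖c)+(a↖c)·b = b↙(a↙c)+(a↙c)↗b+a·(b↖c)+(b↖c)·a; with (15) as given the claim fails (A=span{x,y}, x↙y=y the only nonzero product). *)

theory Defs
  imports "HOL-Computational_Algebra.Polynomial"
begin

definition bilinear_map ::
  "('k::field \<Rightarrow> 'v::ab_group_add \<Rightarrow> 'v) \<Rightarrow> ('k \<Rightarrow> 'w::ab_group_add \<Rightarrow> 'w) \<Rightarrow> ('v \<Rightarrow> 'v \<Rightarrow> 'w) \<Rightarrow> bool"
  where "bilinear_map s1 s2 f \<longleftrightarrow>
    (\<forall>x. Vector_Spaces.linear s1 s2 (\<lambda>y. f x y)) \<and> (\<forall>y. Vector_Spaces.linear s1 s2 (\<lambda>x. f x y))"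


section \<open>Lambda-products on \<open>k[\<partial>]\<close>-modules\<close>

text \<open>
  A \<open>k[\<partial>]\<close>-module is a module \<open>act\<close> over \<^typ>\<open>'k poly\<close>; the indeterminate of \<^typ>\<open>'k poly\<close> is \<open>\<partial>\<close>,
  and the constants give the underlying \<open>k\<close>-vector space. A \<open>\<lambda>\<close>-product takes values in \<^typ>\<open>'m poly\<close>,
  which stands for \<open>M[\<lambda>]\<close>.
\<close>

definition kscale :: "('k::field_char_0 poly \<Rightarrow> 'm::ab_group_add \<Rightarrow> 'm) \<Rightarrow> 'k \<Rightarrow> 'm \<Rightarrow> 'm"
  where "kscale act c = act [:c:]"

definition dd :: "('k::field_char_0 poly \<Rightarrow> 'm::ab_group_add \<Rightarrow> 'm) \<Rightarrow> 'm \<Rightarrow> 'm"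
  where "dd act = act [:0, 1:]"

definition lambda_product ::
  "('k::field_char_0 poly \<Rightarrow> 'm::ab_group_add \<Rightarrow> 'm) \<Rightarrow> ('m \<Rightarrow> 'm \<Rightarrow> 'm poly) \<Rightarrow> bool"
  where "lambda_product act P \<longleftrightarrow>
    bilinear_map (kscale act) (\<lambda>c. map_poly (kscale act c)) P \<and>
    (\<forall>a b. P (dd act a) b = - pCons 0 (P a b)) \<and>
    (\<forall>a b. P a (dd act b) = pCons 0 (P a b) + map_poly (dd act) (P a b))"

text \<open>
  Identities in two formal variables are stated in \<open>M[\<lambda>][\<mu>]\<close>, represented by \<^typ>\<open>'m poly poly\<close>:
  the outer variable is \<open>\<lambda>\<close>, the inner one is \<open>\<mu>\<close>. The variables and \<open>\<partial>\<close> act on it as the commuting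
  operators \<open>Lam\<close>, \<open>Mu\<close> and \<open>Del\<close>, where \<open>Del\<close> acts on the coefficients.
\<close>

definition Const :: "'m::zero \<Rightarrow> 'm poly poly" ("\<iota>")
  where "\<iota> a = [:[:a:]:]"

definition Lam :: "'m::zero poly poly \<Rightarrow> 'm poly poly"
  where "Lam X = pCons 0 X"

definition Mu :: "'m::zero poly poly \<Rightarrow> 'm poly poly"
  where "Mu X = map_poly (pCons 0) X"

definition Del :: "('k::field_char_0 poly \<Rightarrow> 'm::ab_group_add \<Rightarrow> 'm) \<Rightarrow> 'm poly poly \<Rightarrow> 'm poly poly"
  where "Del act X = map_poly (map_poly (dd act)) X"

text \<open>
  \<open>subst_var T p\<close> replaces the variable of \<open>p\<close> by the operator \<open>T\<close>, acting from the left on the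
  coefficients. \<open>prod_at P T X Y\<close> is the product \<open>X *\<^sub>T Y\<close>, where \<open>P\<close> is extended to polynomial
  arguments by \<open>k[\<lambda>,\<mu>]\<close>-bilinearity:
  \<open>(\<lambda>\<^sup>i \<mu>\<^sup>j x) *\<^sub>T (\<lambda>\<^sup>k \<mu>\<^sup>l y) = \<lambda>\<^sup>i\<^sup>+\<^sup>k \<mu>\<^sup>j\<^sup>+\<^sup>l (x *\<^sub>T y)\<close>.
\<close>

definition subst_var ::
  "('m::ab_group_add poly poly \<Rightarrow> 'm poly poly) \<Rightarrow> 'm poly \<Rightarrow> 'm poly poly"
  where "subst_var T p = (\<Sum>n\<le>degree p. (T ^^ n) (Const (coeff p n)))"

definition prod_at ::
  "('m::ab_group_add \<Rightarrow> 'm \<Rightarrow> 'm poly) \<Rightarrow> ('m poly poly \<Rightarrow> 'm poly poly) \<Rightarrow>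
   'm poly poly \<Rightarrow> 'm poly poly \<Rightarrow> 'm poly poly"
  where "prod_at P T X Y =
    (\<Sum>i\<le>degree X. \<Sum>j\<le>degree (coeff X i). \<Sum>k\<le>degree Y. \<Sum>l\<le>degree (coeff Y k).
       (Lam ^^ (i + k)) ((Mu ^^ (j + l))
         (subst_var T (P (coeff (coeff X i) j) (coeff (coeff Y k) l)))))"

abbreviation prod_at_infix ("_ \<star>[_,/ _] _" [71, 0, 0, 71] 70)
  where "X \<star>[P, T] Y \<equiv> prod_at P T X Y"


section \<open>Lie conformal algebras and partial-pre-post-Lie conformal algebras\<close>

definition LamMu :: "'m::ab_group_add poly poly \<Rightarrow> 'm poly poly"
  where "LamMu X = Lam X + Mu X"

definition LamDel :: "('k::field_char_0 poly \<Rightarrow> 'm::ab_group_add \<Rightarrow> 'm) \<Rightarrow> 'm poly poly \<Rightarrow> 'm poly poly"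
  where "LamDel act X = - Lam X - Del act X"

definition MuDel :: "('k::field_char_0 poly \<Rightarrow> 'm::ab_group_add \<Rightarrow> 'm) \<Rightarrow> 'm poly poly \<Rightarrow> 'm poly poly"
  where "MuDel act X = - Mu X - Del act X"

locale Lie_conformal_algebra = module act
  for act :: "'k::field_char_0 poly \<Rightarrow> 'm::ab_group_add \<Rightarrow> 'm" +
  fixes br :: "'m \<Rightarrow> 'm \<Rightarrow> 'm poly"
  assumes lambda_product_br: "lambda_product act br"
    and skew_symmetry:
      "\<iota> a \<star>[br, Lam] \<iota> b = - (\<iota> b \<star>[br, LamDel act] \<iota> a)"
    and Jacobi:
      "\<iota> a \<star>[br, Lam] (\<iota> b \<star>[br, Mu] \<iota> c) =
       (\<iota> a \<star>[br, Lam] \<iota> b) \<star>[br, LamMu] \<iota> c + \<iota> b \<star>[br, Mu] (\<iota> a \<star>[br, Lam] \<iota> c)"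

definition curly ::
  "('k::field_char_0 poly \<Rightarrow> 'm::ab_group_add \<Rightarrow> 'm) \<Rightarrow> ('m \<Rightarrow> 'm \<Rightarrow> 'm poly) \<Rightarrow>
   ('m \<Rightarrow> 'm \<Rightarrow> 'm poly) \<Rightarrow> ('m \<Rightarrow> 'm \<Rightarrow> 'm poly) \<Rightarrow> 'm \<Rightarrow> 'm \<Rightarrow> 'm poly poly"
  where "curly act br lh rh a b =
    \<iota> a \<star>[rh, Lam] \<iota> b + \<iota> a \<star>[lh, Lam] \<iota> b
    - \<iota> b \<star>[rh, LamDel act] \<iota> a - \<iota> b \<star>[lh, LamDel act] \<iota> a + \<iota> a \<star>[br, Lam] \<iota> b"

text \<open>\<open>lh\<close> and \<open>rh\<close> are the products \<open>\<lhd>\<close> and \<open>\<rhd>\<close>.\<close>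

locale partial_pre_post_Lie_conformal_algebra = Lie_conformal_algebra act br
  for act :: "'k::field_char_0 poly \<Rightarrow> 'm::ab_group_add \<Rightarrow> 'm" and br +
  fixes lh rh :: "'m \<Rightarrow> 'm \<Rightarrow> 'm poly"
  assumes lambda_product_lh: "lambda_product act lh"
    and lambda_product_rh: "lambda_product act rh"
    and ppp_Lie_1:
      "\<iota> a \<star>[lh, Lam] (\<iota> b \<star>[br, Mu] \<iota> c) =
       (\<iota> a \<star>[br, Lam] \<iota> b) \<star>[lh, LamMu] \<iota> c - (\<iota> a \<star>[br, Lam] \<iota> c) \<star>[lh, MuDel act] \<iota> b"
    and ppp_Lie_2:
      "\<iota> a \<star>[br, Lam] (\<iota> b \<star>[lh, Mu] \<iota> c + \<iota> c \<star>[lh, MuDel act] \<iota> b) =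
       (\<iota> a \<star>[br, Lam] \<iota> c) \<star>[lh, MuDel act] \<iota> b + \<iota> b \<star>[lh, Mu] (\<iota> a \<star>[br, Lam] \<iota> c)"
    and ppp_Lie_3:
      "\<iota> a \<star>[rh, Lam] (\<iota> b \<star>[br, Mu] \<iota> c) - (\<iota> b \<star>[br, Mu] \<iota> c) \<star>[lh, LamDel act] \<iota> a =
       (\<iota> a \<star>[rh, Lam] \<iota> b + \<iota> a \<star>[lh, Lam] \<iota> b) \<star>[br, LamMu] \<iota> c
       + \<iota> b \<star>[br, Mu] (\<iota> a \<star>[rh, Lam] \<iota> c - \<iota> c \<star>[lh, LamDel act] \<iota> a)"
    and ppp_Lie_4:
      "curly act br lh rh a b \<star>[rh, LamMu] \<iota> c =
       \<iota> a \<star>[rh, Lam] (\<iota> b \<star>[rh, Mu] \<iota> c) - \<iota> b \<star>[rh, Mu] (\<iota> a \<star>[rh, Lam] \<iota> c)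
       + \<iota> b \<star>[br, Mu] (\<iota> a \<star>[lh, Lam] \<iota> c) - \<iota> a \<star>[br, Lam] (\<iota> b \<star>[lh, Mu] \<iota> c)
       - (\<iota> a \<star>[br, Lam] \<iota> b) \<star>[lh, LamMu] \<iota> c"
    and ppp_Lie_5:
      "(\<iota> a \<star>[rh, Lam] \<iota> b - \<iota> b \<star>[lh, Mu] \<iota> a) \<star>[lh, LamMu] \<iota> c
       + \<iota> b \<star>[lh, Mu] (\<iota> a \<star>[rh, Lam] \<iota> c + \<iota> a \<star>[lh, Lam] \<iota> c) =
       \<iota> a \<star>[rh, Lam] (\<iota> b \<star>[lh, Mu] \<iota> c) + \<iota> a \<star>[br, Lam] (\<iota> b \<star>[lh, Mu] \<iota> c)"

locale special_partial_pre_post_Lie_conformal_algebra =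
  partial_pre_post_Lie_conformal_algebra act br lh rh
  for act :: "'k::field_char_0 poly \<Rightarrow> 'm::ab_group_add \<Rightarrow> 'm" and br lh rh +
  assumes special_lh: "\<iota> a \<star>[lh, Lam] \<iota> b = - (\<iota> b \<star>[lh, LamDel act] \<iota> a)"


section \<open>Novikov algebras and partial-pre-post-Novikov algebras\<close>

locale Novikov_algebra = vector_space scale
  for scale :: "'k::field_char_0 \<Rightarrow> 'a::ab_group_add \<Rightarrow> 'a" +
  fixes mul :: "'a \<Rightarrow> 'a \<Rightarrow> 'a" (infixl "\<cdot>" 70)
  assumes bilinear_mul: "bilinear_map scale scale mul"
    and left_symmetry:
      "(a \<cdot> b) \<cdot> c - a \<cdot> (b \<cdot> c) = (b \<cdot> a) \<cdot> c - b \<cdot> (a \<cdot> c)"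
    and right_commutativity: "(a \<cdot> b) \<cdot> c = (a \<cdot> c) \<cdot> b"

text \<open>
  The identity \<open>ppp_Nov_15\<close> is the coefficient of \<open>\<lambda>\<mu>\<close> in \<open>ppp_Lie_4\<close> for the products below, reduced
  by the other identities, so the \<open>\<cdot>\<close>-products on its two sides involve \<open>\<nwarrow>\<close> (equivalently \<open>\<searrow>\<close>,
  by \<open>ppp_Nov_7_left\<close> and \<open>ppp_Nov_7_right\<close>) and it is skew under exchange of \<open>a\<close> and \<open>b\<close>. Its
  variant \<open>a \<swarrow> (b \<swarrow> c) + (b \<swarrow> c) \<nearrow> a + b \<cdot> (a \<swarrow> c) + (a \<swarrow> c) \<cdot> b =
  b \<swarrow> (a \<searrow> c) + (a \<swarrow> c) \<nearrow> b + a \<cdot> (b \<swarrow> c) + (b \<swarrow> c) \<cdot> a\<close>, which occurs in print, is a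
  misprint: it fails on the plane spanned by \<open>x, y\<close> with \<open>x \<swarrow> y = y\<close> as the only nonzero product of
  basis elements, although the corresponding \<open>R(A)\<close> is a partial-pre-post-Lie conformal algebra.
\<close>

locale partial_pre_post_Novikov_algebra = Novikov_algebra scale mul
  for scale :: "'k::field_char_0 \<Rightarrow> 'a::ab_group_add \<Rightarrow> 'a" and mul (infixl "\<cdot>" 70) +
  fixes ne :: "'a \<Rightarrow> 'a \<Rightarrow> 'a" (infixl "\<nearrow>" 70)
    and se :: "'a \<Rightarrow> 'a \<Rightarrow> 'a" (infixl "\<searrow>" 70)
    and nw :: "'a \<Rightarrow> 'a \<Rightarrow> 'a" (infixl "\<nwarrow>" 70)
    and sw :: "'a \<Rightarrow> 'a \<Rightarrow> 'a" (infixl "\<swarrow>" 70)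
  assumes bilinear_ne: "bilinear_map scale scale ne"
    and bilinear_se: "bilinear_map scale scale se"
    and bilinear_nw: "bilinear_map scale scale nw"
    and bilinear_sw: "bilinear_map scale scale sw"
    and ppp_Nov_1: "(c \<nwarrow> b + c \<nearrow> b) \<cdot> a = (c \<cdot> a) \<nwarrow> b + (c \<cdot> a) \<nearrow> b"
    and ppp_Nov_2: "a \<cdot> (c \<nearrow> b + c \<nwarrow> b) + (c \<nearrow> b + c \<nwarrow> b) \<cdot> a =
      (a \<nearrow> b + a \<searrow> b) \<cdot> c + c \<cdot> (a \<nearrow> b + a \<searrow> b)"
    and ppp_Nov_3: "(a \<cdot> b) \<searrow> c + c \<nwarrow> (a \<cdot> b) = a \<searrow> (c \<cdot> b) + (c \<cdot> b) \<nwarrow> a"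
    and ppp_Nov_4_left: "(c \<cdot> b) \<nwarrow> a = (c \<cdot> a) \<nwarrow> b"
    and ppp_Nov_4_right: "(c \<cdot> a) \<nwarrow> b = (c \<cdot> b) \<searrow> a"
    and ppp_Nov_5: "(a \<nwarrow> b + a \<swarrow> b) \<cdot> c + c \<cdot> (a \<nwarrow> b + a \<swarrow> b) =
      a \<swarrow> (c \<cdot> b) + a \<searrow> (c \<cdot> b) + (c \<cdot> b) \<nwarrow> a + (c \<cdot> b) \<nearrow> a"
    and ppp_Nov_6: "a \<searrow> (b \<cdot> c) + (b \<cdot> c) \<nwarrow> a = b \<searrow> (a \<cdot> c) + (a \<cdot> c) \<nwarrow> b"
    and ppp_Nov_7_left: "(a \<nwarrow> b - a \<searrow> b) \<cdot> c = c \<cdot> (a \<searrow> b - a \<nwarrow> b)"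
    and ppp_Nov_7_right: "c \<cdot> (a \<searrow> b - a \<nwarrow> b) = 0"
    and ppp_Nov_8: "(a \<swarrow> c + a \<searrow> c) \<cdot> b = (a \<nwarrow> b + a \<swarrow> b) \<cdot> c"
    and ppp_Nov_9: "(a \<nwarrow> b + a \<swarrow> b) \<searrow> c + c \<nwarrow> (a \<nwarrow> b + a \<swarrow> b) =
      a \<cdot> (c \<nwarrow> b) + (c \<nwarrow> b) \<cdot> a + a \<swarrow> (c \<nwarrow> b) + (c \<nwarrow> b) \<nearrow> a"
    and ppp_Nov_10: "a \<swarrow> (c \<nearrow> b) + (c \<nearrow> b) \<nearrow> a + (a \<searrow> c) \<cdot> b =
      c \<nearrow> (a \<nwarrow> b + a \<nearrow> b + a \<swarrow> b + a \<searrow> b + a \<cdot> b) + c \<nwarrow> (a \<cdot> b)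
      + a \<cdot> (c \<nwarrow> b) + (c \<nwarrow> b) \<cdot> a + (a \<swarrow> c) \<nearrow> b"
    and ppp_Nov_11: "(a \<nwarrow> b + a \<nearrow> b) \<nwarrow> c = (a \<nwarrow> c) \<nearrow> b + (a \<nwarrow> c) \<cdot> b"
    and ppp_Nov_12:
      "(a \<nwarrow> b + a \<nearrow> b + a \<swarrow> b + a \<searrow> b + a \<cdot> b) \<swarrow> c + (a \<searrow> c) \<cdot> b + (a \<cdot> b) \<searrow> c =
      (a \<swarrow> c) \<nearrow> b"
    and ppp_Nov_13: "a \<swarrow> (c \<searrow> b) + (c \<searrow> b) \<nearrow> a + a \<cdot> (c \<searrow> b) + (c \<searrow> b) \<cdot> a =
      c \<searrow> (a \<swarrow> b + a \<searrow> b) + (a \<swarrow> b + a \<searrow> b) \<nwarrow> c"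
    and ppp_Nov_14: "(c \<nearrow> a + c \<searrow> a) \<searrow> b = (c \<searrow> b) \<nearrow> a + (c \<searrow> b) \<cdot> a"
    and ppp_Nov_15: "a \<swarrow> (b \<swarrow> c) + (b \<swarrow> c) \<nearrow> a + b \<cdot> (a \<nwarrow> c) + (a \<nwarrow> c) \<cdot> b =
      b \<swarrow> (a \<swarrow> c) + (a \<swarrow> c) \<nearrow> b + a \<cdot> (b \<nwarrow> c) + (b \<nwarrow> c) \<cdot> a"
    and ppp_Nov_16: "(a \<nwarrow> b + a \<swarrow> b) \<searrow> c = (a \<swarrow> c + a \<searrow> c) \<nwarrow> b"
    and ppp_Nov_17: "(a \<nearrow> b + a \<searrow> b) \<searrow> c + c \<nwarrow> (a \<nearrow> b + a \<searrow> b) =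
      a \<searrow> (c \<nearrow> b + c \<nwarrow> b) + (c \<nearrow> b + c \<nwarrow> b) \<nwarrow> a"
    and ppp_Nov_18: "(a \<nearrow> b) \<nearrow> c + (a \<searrow> c) \<cdot> b = (a \<nearrow> c) \<nearrow> b + (a \<searrow> b) \<cdot> c"

locale special_partial_pre_post_Novikov_algebra =
  partial_pre_post_Novikov_algebra scale mul ne se nw sw
  for scale :: "'k::field_char_0 \<Rightarrow> 'a::ab_group_add \<Rightarrow> 'a" and mul ne se nw sw +
  assumes special_se_nw: "se a b = nw a b"


section \<open>The \<open>k[\<partial>]\<close>-module \<open>R(A)\<close> and its products\<close>

text \<open>
  \<open>R(A) = k[\<partial>] \<otimes> A\<close> is represented by \<^typ>\<open>'a poly\<close> with indeterminate \<open>\<partial>\<close>: \<open>\<partial>\<^sup>n \<otimes> a\<close> is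
  \<^term>\<open>monom a n\<close>. Then \<open>R(A)[\<lambda>]\<close> is \<^typ>\<open>'a poly poly\<close>, whose outer variable is \<open>\<lambda>\<close> and whose
  inner variable is \<open>\<partial>\<close>.
\<close>

definition RA_act ::
  "('k::field_char_0 \<Rightarrow> 'a::ab_group_add \<Rightarrow> 'a) \<Rightarrow> 'k poly \<Rightarrow> 'a poly \<Rightarrow> 'a poly"
  where "RA_act scale p u =
    (\<Sum>i\<le>degree p. \<Sum>j\<le>degree u. monom (scale (coeff p i) (coeff u j)) (i + j))"

text \<open>
  The extension of \<open>f : A \<times> A \<rightarrow> R(A)[\<lambda>]\<close> by conformal sesquilinearity:
  \<open>(\<partial>\<^sup>i a) *\<^sub>\<lambda> (\<partial>\<^sup>j b) = (-\<lambda>)\<^sup>i (\<lambda>+\<partial>)\<^sup>j (a *\<^sub>\<lambda> b)\<close>.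
\<close>

definition sesquilinear_ext ::
  "('a::ab_group_add \<Rightarrow> 'a \<Rightarrow> 'a poly poly) \<Rightarrow> 'a poly \<Rightarrow> 'a poly \<Rightarrow> 'a poly poly"
  where "sesquilinear_ext f u v =
    (\<Sum>i\<le>degree u. \<Sum>j\<le>degree v.
       ((\<lambda>q. - pCons 0 q) ^^ i) (((\<lambda>q. pCons 0 q + map_poly (pCons 0) q) ^^ j)
         (f (coeff u i) (coeff v j))))"

text \<open>\<open>RA_product f g\<close> is given on \<open>A\<close> by \<open>a *\<^sub>\<lambda> b = \<partial> (f b a) + \<lambda> (g a b + f b a)\<close>.\<close>

definition RA_product ::
  "('a::ab_group_add \<Rightarrow> 'a \<Rightarrow> 'a) \<Rightarrow> ('a \<Rightarrow> 'a \<Rightarrow> 'a) \<Rightarrow> 'a poly \<Rightarrow> 'a poly \<Rightarrow> 'a poly poly"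
  where "RA_product f g =
    sesquilinear_ext (\<lambda>a b. monom (monom (f b a) 1) 0 + monom (monom (g a b + f b a) 0) 1)"

end

theory Submission
  imports Defs
begin

text \<open>
  Every identity of a partial-pre-post-Lie conformal algebra is an equation in \<open>R(A)[\<lambda>,\<mu>]\<close>; call the difference of its
  sides the defect. A defect is trilinear in \<open>a\<close>, \<open>b\<close>, \<open>c\<close>, and a \<open>\<partial>\<close> in front of \<open>a\<close>, \<open>b\<close> or \<open>c\<close> multiplies it by \<open>-\<lambda>\<close>, \<open>-\<mu>\<close> or
  \<open>\<lambda> + \<mu> + \<partial>\<close> (\<open>conformal_trilinear_defects\<close>). Since \<open>A\<close> generates \<open>R(A)\<close> over \<open>k[\<partial>]\<close>, a defect vanishes identically
  as soon as it vanishes for \<open>a\<close>, \<open>b\<close>, \<open>c\<close> in \<open>A\<close> (\<open>conformal_trilinear_vanishes\<close>).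

  On \<open>A\<close> a product with subscript \<open>T\<close> is \<open>\<partial> (f b a) + T (g a b + f b a)\<close>, which is linear in \<open>T\<close> and \<open>\<partial>\<close>. A defect consists of
  twofold products, so on \<open>A\<close> it is a quadratic form in \<open>\<lambda>\<close>, \<open>\<mu>\<close>, \<open>\<partial>\<close> with coefficients in \<open>A\<close>. Such a form vanishes if and
  only if its values at the six points \<open>(1,0,0)\<close>, \<open>(0,1,0)\<close>, \<open>(0,0,1)\<close>, \<open>(1,-1,0)\<close>, \<open>(1,0,-1)\<close>, \<open>(0,1,-1)\<close> vanish
  (\<open>quadratic_eq_0_iff\<close>). Evaluation at these points separates the identities (\<open>Jacobi_defect_constants\<close> and the
  lemmas after it). The values of \<open>ppp_Lie_2_defect\<close> say that \<open>\<nwarrow>\<close> and \<open>\<searrow>\<close> may be interchanged in the presence of \<open>\<cdot>\<close>.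
  Modulo this interchange, and right commutativity in the case of the Jacobi identity, the other values are up to
  sign the differences of the two sides of single identities of a partial-pre-post-Novikov algebra; only one
  value of \<open>ppp_Lie_4_defect\<close>, up to the exchange of \<open>a\<close> and \<open>b\<close>, combines two identities, one of which is also a
  value by itself. Both implications
  follow by reading off the values.

  The skew symmetry of a product built from \<open>f\<close> and \<open>g\<close> amounts to \<open>f = g\<close> (\<open>skew_defect_RA_product_eq_0_iff\<close>). It holds for
  the bracket, where \<open>f\<close> and \<open>g\<close> are both \<open>\<cdot>\<close>, and for \<open>\<lhd>\<close> it is the condition \<open>a \<searrow> b = a \<nwarrow> b\<close>.
\<close>

section \<open>Biadditive maps and the operators of formal variables\<close>

definition biadditive :: "('a::ab_group_add \<Rightarrow> 'b::ab_group_add \<Rightarrow> 'c::ab_group_add) \<Rightarrow> bool"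
  where "biadditive f \<longleftrightarrow> (\<forall>x. additive (f x)) \<and> (\<forall>y. additive (\<lambda>x. f x y))"

lemma biadditiveD:
  assumes "biadditive f"
  shows "f (x + x') y = f x y + f x' y" "f x (y + y') = f x y + f x y'"
    "f 0 y = 0" "f x 0 = 0" "f (- x) y = - f x y" "f x (- y) = - f x y"
    "f (x - x') y = f x y - f x' y" "f x (y - y') = f x y - f x y'"
proof -
  have l: "additive (\<lambda>x. f x y)" for y using assms by (simp add: biadditive_def)
  have r: "additive (f x)" for x using assms by (simp add: biadditive_def)
  show "f (x + x') y = f x y + f x' y" "f 0 y = 0" "f (- x) y = - f x y" "f (x - x') y = f x y - f x' y"
    using additive.add[OF l] additive.zero[OF l] additive.minus[OF l] additive.diff[OF l] by auto
  show "f x (y + y') = f x y + f x y'" "f x 0 = 0" "f x (- y) = - f x y" "f x (y - y') = f x y - f x y'"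
    using additive.add[OF r] additive.zero[OF r] additive.minus[OF r] additive.diff[OF r] by auto
qed

lemma biadditiveI:
  assumes "\<And>x x' y. f (x + x') y = f x y + f x' y" "\<And>x y y'. f x (y + y') = f x y + f x y'"
  shows "biadditive f"
  using assms by (simp add: biadditive_def additive_def)

lemma biadditive_flip: "biadditive f \<Longrightarrow> biadditive (\<lambda>x y. f y x)"
  by (simp add: biadditive_def)

lemma additive_funpow:
  fixes T :: "'a::ab_group_add \<Rightarrow> 'a"
  shows "additive T \<Longrightarrow> additive (T ^^ n)"
  by (induction n) (simp_all add: additive_def)

lemma additive_map_poly: "additive f \<Longrightarrow> additive (map_poly f)"
  by (auto simp: additive_def intro!: poly_eqI)
     (simp add: additive_def additive.zero coeff_map_poly)

lemma additive_pCons_0: "additive (pCons 0 :: 'a::ab_group_add poly \<Rightarrow> _)"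
  by (simp add: additive_def)

lemma additive_Lam: "additive (Lam :: 'm::ab_group_add poly poly \<Rightarrow> _)"
  by (simp add: additive_def Lam_def)

lemma additive_Mu: "additive (Mu :: 'm::ab_group_add poly poly \<Rightarrow> _)"
  unfolding Mu_def by (intro additive_map_poly additive_pCons_0)

lemma additive_Const: "additive (\<iota> :: 'm::ab_group_add \<Rightarrow> _)"
  by (simp add: additive_def Const_def)

lemma Mu_Lam: "Mu (Lam X) = Lam (Mu (X :: 'm::ab_group_add poly poly))"
  by (simp add: Mu_def Lam_def map_poly_pCons)

lemma coeff_Lam: "coeff (Lam X) i = (case i of 0 \<Rightarrow> 0 | Suc n \<Rightarrow> coeff X n)"
  by (simp add: Lam_def coeff_pCons)

lemma coeff_Mu: "coeff (Mu X) i = pCons 0 (coeff X i)"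
  by (simp add: Mu_def coeff_map_poly)

lemmas Lam_additive =
  additive.add[OF additive_Lam] additive.zero[OF additive_Lam]
  additive.minus[OF additive_Lam] additive.diff[OF additive_Lam]

lemmas Mu_additive =
  additive.add[OF additive_Mu] additive.zero[OF additive_Mu]
  additive.minus[OF additive_Mu] additive.diff[OF additive_Mu]

lemmas Const_additive =
  additive.add[OF additive_Const] additive.zero[OF additive_Const]
  additive.minus[OF additive_Const] additive.diff[OF additive_Const]

section \<open>The calculus of products at an operator\<close>

lemma subst_var_bound:
  assumes "additive T" "degree p \<le> N"
  shows "subst_var T p = (\<Sum>n\<le>N. (T ^^ n) (\<iota> (coeff p n)))"
  unfolding subst_var_def
proof (rule sum.mono_neutral_left)
  show "\<forall>n\<in>{..N} - {..degree p}. (T ^^ n) (\<iota> (coeff p n)) = 0"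
    by (auto simp: coeff_eq_0 Const_additive additive.zero[OF additive_funpow[OF assms(1)]])
qed (use assms in auto)

lemma additive_subst_var:
  assumes "additive T"
  shows "additive (subst_var T)"
proof
  fix p q :: "'a poly"
  define N where "N = max (degree p) (degree q)"
  have "degree p \<le> N" "degree q \<le> N" "degree (p + q) \<le> N"
    by (auto simp: N_def intro: degree_add_le)
  then show "subst_var T (p + q) = subst_var T p + subst_var T q"
    by (simp add: subst_var_bound[OF assms] Const_additive
        additive.add[OF additive_funpow[OF assms]] sum.distrib)
qed

text \<open>
  Horner's rule. Together with additivity it determines \<open>subst_var T\<close>, and it allows induction over the
  substituted polynomial.
\<close>

lemma subst_var_pCons:
  assumes "additive T"
  shows "subst_var T (pCons a p) = \<iota> a + T (subst_var T p)"
proof -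
  have "degree (pCons a p) \<le> Suc (degree p)" by (simp add: degree_pCons_le)
  then have "subst_var T (pCons a p) = (\<Sum>n\<le>Suc (degree p). (T ^^ n) (\<iota> (coeff (pCons a p) n)))"
    by (rule subst_var_bound[OF assms])
  also have "\<dots> = \<iota> a + (\<Sum>n\<le>degree p. T ((T ^^ n) (\<iota> (coeff p n))))"
    by (subst sum.atMost_Suc_shift) simp
  also have "\<dots> = \<iota> a + T (subst_var T p)"
    by (simp add: subst_var_def additive.sum[OF assms])
  finally show ?thesis .
qed

text \<open>
  In \<open>prod_at\<close> the ranges of summation depend on the degrees of the arguments. With a common bound \<open>N\<close> the
  sums for different arguments run over the same indices and can be compared termwise.
\<close>

lemma prod_at_bound:
  fixes P :: "'m::ab_group_add \<Rightarrow> 'm \<Rightarrow> 'm poly"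
  assumes T: "additive T" and P: "biadditive P"
    and X: "degree X \<le> N" "\<And>i. degree (coeff X i) \<le> N"
    and Y: "degree Y \<le> N" "\<And>i. degree (coeff Y i) \<le> N"
  shows "X \<star>[P, T] Y = (\<Sum>i\<le>N. \<Sum>j\<le>N. \<Sum>k\<le>N. \<Sum>l\<le>N.
       (Lam ^^ (i + k)) ((Mu ^^ (j + l))
         (subst_var T (P (coeff (coeff X i) j) (coeff (coeff Y k) l)))))"
proof -
  note z = biadditiveD(3,4)[OF P] additive.zero[OF additive_subst_var[OF T]] coeff_eq_0
    additive.zero[OF additive_funpow[OF additive_Lam]] additive.zero[OF additive_funpow[OF additive_Mu]]
  show ?thesis
    unfolding prod_at_def
    by (rule sum.mono_neutral_cong_left; (use X Y in \<open>auto simp: z\<close>)?;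
        (rule sum.mono_neutral_cong_left; (use X Y in \<open>auto simp: z\<close>)?)+)
qed

lemma poly_poly_bound:
  obtains N where "degree X \<le> N" "\<And>i. degree (coeff X i) \<le> N"
proof -
  define N where "N = Max (insert (degree X) ((\<lambda>i. degree (coeff X i)) ` {..degree X}))"
  have "degree X \<le> N" unfolding N_def by simp
  moreover have "degree (coeff X i) \<le> N" for i
  proof (cases "i \<le> degree X")
    case True
    then show ?thesis unfolding N_def by (intro Max_ge) auto
  qed (simp add: coeff_eq_0)
  ultimately show thesis by (rule that)
qed

lemma poly_poly_bound2:
  obtains N where "degree X \<le> N" "\<And>i. degree (coeff X i) \<le> N" "degree Y \<le> N" "\<And>i. degree (coeff Y i) \<le> N"
proof -
  obtain M where "degree X \<le> M" "\<And>i. degree (coeff X i) \<le> M" using poly_poly_bound by blast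
  moreover obtain N where "degree Y \<le> N" "\<And>i. degree (coeff Y i) \<le> N" using poly_poly_bound by blast
  ultimately show thesis by (intro that[of "max M N"]) (auto simp: max.coboundedI1 max.coboundedI2)
qed

text \<open>
  Exchanging the arguments turns each rule for the left argument into one for the right argument.
\<close>

lemma prod_at_flip:
  assumes "additive T" "biadditive P"
  shows "X \<star>[P, T] Y = Y \<star>[\<lambda>x y. P y x, T] X"
proof -
  obtain N where N: "degree X \<le> N" "\<And>i. degree (coeff X i) \<le> N" "degree Y \<le> N" "\<And>i. degree (coeff Y i) \<le> N"
    using poly_poly_bound2 by blast
  let ?F = "\<lambda>i j k l. (Lam ^^ (i + k)) ((Mu ^^ (j + l))
         (subst_var T (P (coeff (coeff X i) j) (coeff (coeff Y k) l))))"
  have "X \<star>[P, T] Y = (\<Sum>i\<le>N. \<Sum>k\<le>N. \<Sum>j\<le>N. \<Sum>l\<le>N. ?F i j k l)"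
    unfolding prod_at_bound[OF assms N] by (rule sum.cong[OF refl]) (rule sum.swap)
  also have "\<dots> = (\<Sum>k\<le>N. \<Sum>i\<le>N. \<Sum>j\<le>N. \<Sum>l\<le>N. ?F i j k l)"
    by (rule sum.swap)
  also have "\<dots> = (\<Sum>k\<le>N. \<Sum>i\<le>N. \<Sum>l\<le>N. \<Sum>j\<le>N. ?F i j k l)"
    by (rule sum.cong[OF refl], rule sum.cong[OF refl]) (rule sum.swap)
  also have "\<dots> = (\<Sum>k\<le>N. \<Sum>l\<le>N. \<Sum>i\<le>N. \<Sum>j\<le>N. ?F i j k l)"
    by (rule sum.cong[OF refl]) (rule sum.swap)
  finally show ?thesis
    unfolding prod_at_bound[OF assms(1) biadditive_flip[OF assms(2)] N(3,4,1,2)]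
    by (simp add: add.commute)
qed

lemma prod_at_add_left:
  assumes T: "additive T" and P: "biadditive P"
  shows "(X + X') \<star>[P, T] Y = X \<star>[P, T] Y + X' \<star>[P, T] Y"
proof -
  obtain M where M: "degree X \<le> M" "\<And>i. degree (coeff X i) \<le> M" "degree Y \<le> M" "\<And>i. degree (coeff Y i) \<le> M"
    using poly_poly_bound2 by blast
  obtain N where N: "degree X' \<le> N" "\<And>i. degree (coeff X' i) \<le> N"
    using poly_poly_bound by blast
  let ?N = "max M N"
  have X: "degree X \<le> ?N" "\<And>i. degree (coeff X i) \<le> ?N"
    and X': "degree X' \<le> ?N" "\<And>i. degree (coeff X' i) \<le> ?N"
    and Y: "degree Y \<le> ?N" "\<And>i. degree (coeff Y i) \<le> ?N"
    using M N by (auto simp: max.coboundedI1 max.coboundedI2)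
  have XX': "degree (X + X') \<le> ?N" "\<And>i. degree (coeff (X + X') i) \<le> ?N"
    using X X' by (auto intro!: degree_add_le simp del: max.bounded_iff le_max_iff_disj)
  show ?thesis
    unfolding prod_at_bound[OF T P XX' Y] prod_at_bound[OF T P X Y] prod_at_bound[OF T P X' Y]
    by (simp only: coeff_add biadditiveD(1)[OF P] additive.add[OF additive_subst_var[OF T]]
        additive.add[OF additive_funpow[OF additive_Lam]] additive.add[OF additive_funpow[OF additive_Mu]]
        sum.distrib)
qed

lemma biadditive_prod_at:
  assumes T: "additive T" and P: "biadditive P"
  shows "biadditive (prod_at P T)"
proof (rule biadditiveI)
  show "(X + X') \<star>[P, T] Y = X \<star>[P, T] Y + X' \<star>[P, T] Y" for X X' Y
    by (rule prod_at_add_left[OF assms])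
  show "X \<star>[P, T] (Y + Y') = X \<star>[P, T] Y + X \<star>[P, T] Y'" for X Y Y'
    unfolding prod_at_flip[OF assms, of X]
    by (rule prod_at_add_left[OF T biadditive_flip[OF P]])
qed

lemma prod_at_Lam_left:
  assumes T: "additive T" and P: "biadditive P"
  shows "Lam X \<star>[P, T] Y = Lam (X \<star>[P, T] Y)"
proof -
  obtain N where N: "degree X \<le> N" "\<And>i. degree (coeff X i) \<le> N" "degree Y \<le> N" "\<And>i. degree (coeff Y i) \<le> N"
    using poly_poly_bound2 by blast
  have S: "degree X \<le> Suc N" "\<And>i. degree (coeff X i) \<le> Suc N" "degree Y \<le> Suc N" "\<And>i. degree (coeff Y i) \<le> Suc N"
    using N by (simp_all add: le_SucI)
  have L: "degree (Lam X) \<le> Suc N" "\<And>i. degree (coeff (Lam X) i) \<le> Suc N"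
    using N degree_pCons_le[of 0 X] by (auto simp: Lam_def coeff_pCons le_SucI split: nat.splits)
  note z = biadditiveD(3,4)[OF P] additive.zero[OF additive_subst_var[OF T]] coeff_eq_0
    additive.zero[OF additive_funpow[OF additive_Lam]] additive.zero[OF additive_funpow[OF additive_Mu]]
  have "Lam X \<star>[P, T] Y = (\<Sum>i\<le>N. \<Sum>j\<le>Suc N. \<Sum>k\<le>Suc N. \<Sum>l\<le>Suc N. Lam ((Lam ^^ (i + k)) ((Mu ^^ (j + l))
         (subst_var T (P (coeff (coeff X i) j) (coeff (coeff Y k) l))))))"
    unfolding prod_at_bound[OF T P L S(3,4)]
    by (subst sum.atMost_Suc_shift) (simp add: coeff_Lam z)
  also have "\<dots> = (\<Sum>i\<le>Suc N. \<Sum>j\<le>Suc N. \<Sum>k\<le>Suc N. \<Sum>l\<le>Suc N. Lam ((Lam ^^ (i + k)) ((Mu ^^ (j + l))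
         (subst_var T (P (coeff (coeff X i) j) (coeff (coeff Y k) l))))))"
    using N(1) by (subst (2) sum.atMost_Suc) (simp add: coeff_eq_0 z Lam_additive)
  finally show ?thesis
    unfolding prod_at_bound[OF T P S] by (simp only: additive.sum[OF additive_Lam])
qed

lemma prod_at_Mu_left:
  assumes T: "additive T" and P: "biadditive P"
  shows "Mu X \<star>[P, T] Y = Mu (X \<star>[P, T] Y)"
proof -
  obtain N where N: "degree X \<le> N" "\<And>i. degree (coeff X i) \<le> N" "degree Y \<le> N" "\<And>i. degree (coeff Y i) \<le> N"
    using poly_poly_bound2 by blast
  have S: "degree X \<le> Suc N" "\<And>i. degree (coeff X i) \<le> Suc N" "degree Y \<le> Suc N" "\<And>i. degree (coeff Y i) \<le> Suc N"
    using N by (simp_all add: le_SucI)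
  have M: "degree (Mu X) \<le> Suc N" "\<And>i. degree (coeff (Mu X) i) \<le> Suc N"
    using N by (auto simp: Mu_def coeff_map_poly intro: order_trans[OF map_poly_degree_leq] order_trans[OF degree_pCons_le] le_SucI)
  note z = biadditiveD(3,4)[OF P] additive.zero[OF additive_subst_var[OF T]]
    additive.zero[OF additive_funpow[OF additive_Lam]] additive.zero[OF additive_funpow[OF additive_Mu]]
  have comm: "(Lam ^^ n) (Mu Z) = Mu ((Lam ^^ n) Z)" for n and Z :: "'a poly poly"
    by (induction n) (simp_all add: Mu_Lam)
  have "(\<Sum>j\<le>Suc N. \<Sum>k\<le>Suc N. \<Sum>l\<le>Suc N. (Lam ^^ (i + k)) ((Mu ^^ (j + l))
         (subst_var T (P (coeff (coeff (Mu X) i) j) (coeff (coeff Y k) l)))))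
    = (\<Sum>j\<le>Suc N. \<Sum>k\<le>Suc N. \<Sum>l\<le>Suc N. Mu ((Lam ^^ (i + k)) ((Mu ^^ (j + l))
         (subst_var T (P (coeff (coeff X i) j) (coeff (coeff Y k) l))))))" (is "?l i = ?r i") for i
  proof -
    have "?l i = (\<Sum>j\<le>N. \<Sum>k\<le>Suc N. \<Sum>l\<le>Suc N. Mu ((Lam ^^ (i + k)) ((Mu ^^ (j + l))
         (subst_var T (P (coeff (coeff X i) j) (coeff (coeff Y k) l))))))"
      by (subst sum.atMost_Suc_shift) (simp add: coeff_Mu z comm)
    also have "\<dots> = ?r i"
      using N(2)[of i] by (subst (2) sum.atMost_Suc) (simp add: coeff_eq_0 z Mu_additive)
    finally show ?thesis .
  qed
  then show ?thesis
    unfolding prod_at_bound[OF T P M S(3,4)] prod_at_bound[OF T P S]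
    by (simp only: additive.sum[OF additive_Mu])
qed

lemma prod_at_Lam_right:
  assumes "additive T" "biadditive P"
  shows "X \<star>[P, T] Lam Y = Lam (X \<star>[P, T] Y)"
  unfolding prod_at_flip[OF assms, of X]
  by (rule prod_at_Lam_left[OF assms(1) biadditive_flip[OF assms(2)]])

lemma prod_at_Mu_right:
  assumes "additive T" "biadditive P"
  shows "X \<star>[P, T] Mu Y = Mu (X \<star>[P, T] Y)"
  unfolding prod_at_flip[OF assms, of X]
  by (rule prod_at_Mu_left[OF assms(1) biadditive_flip[OF assms(2)]])

lemma prod_at_Const:
  assumes "additive T" "biadditive P"
  shows "\<iota> a \<star>[P, T] \<iota> b = subst_var T (P a b)"
  by (simp add: prod_at_def Const_def)

section \<open>Conformal sesquilinearity of the extended products\<close>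

lemma linear_imp_additive: "Vector_Spaces.linear s1 s2 f \<Longrightarrow> additive f"
  by (simp add: additive_def Vector_Spaces.linear_def module_hom_iff)

lemma bilinear_map_imp_biadditive: "bilinear_map s1 s2 f \<Longrightarrow> biadditive f"
  unfolding bilinear_map_def biadditive_def using linear_imp_additive by blast

lemma lambda_product_imp_biadditive: "lambda_product act P \<Longrightarrow> biadditive P"
  unfolding lambda_product_def using bilinear_map_imp_biadditive by blast

locale conformal_module = module act
  for act :: "'k::field_char_0 poly \<Rightarrow> 'm::ab_group_add \<Rightarrow> 'm"
begin

lemma additive_dd: "additive (dd act)"
  by (simp add: additive_def dd_def scale_right_distrib)

lemma additive_Del: "additive (Del act)"
  unfolding Del_def by (intro additive_map_poly additive_dd)

lemma Del_Lam: "Del act (Lam X) = Lam (Del act X)"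
  by (simp add: Del_def Lam_def map_poly_pCons)

lemma Del_Mu: "Del act (Mu X) = Mu (Del act X)"
  by (auto simp: Del_def Mu_def coeff_map_poly map_poly_pCons additive.zero[OF additive_dd] intro!: poly_eqI)

lemma Del_Const: "Del act (\<iota> a) = \<iota> (dd act a)"
  by (simp add: Del_def Const_def map_poly_pCons additive.zero[OF additive_dd])

text \<open>
  The subscripts \<open>\<lambda>\<close>, \<open>\<mu>\<close>, \<open>\<lambda> + \<mu>\<close>, \<open>-\<lambda> - \<partial>\<close> and \<open>-\<mu> - \<partial>\<close> are polynomials in the operators \<open>\<lambda>\<close>, \<open>\<mu>\<close>, \<open>\<partial>\<close>.
  The rules below depend on no more than that such operators are additive and commute with these three.
\<close>

definition commuting :: "('m poly poly \<Rightarrow> 'm poly poly) \<Rightarrow> bool"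
  where "commuting T \<longleftrightarrow> additive T \<and>
    (\<forall>X. T (Lam X) = Lam (T X) \<and> T (Mu X) = Mu (T X) \<and> T (Del act X) = Del act (T X))"

lemmas Del_additive =
  additive.add[OF additive_Del] additive.zero[OF additive_Del]
  additive.minus[OF additive_Del] additive.diff[OF additive_Del]

lemmas operator_simps = Lam_additive Mu_additive Del_additive Mu_Lam Del_Lam Del_Mu
  LamMu_def LamDel_def MuDel_def

lemma commuting_operators [simp]:
  "commuting Lam" "commuting Mu" "commuting LamMu" "commuting (LamDel act)" "commuting (MuDel act)"
  by (simp_all add: commuting_def additive_def operator_simps algebra_simps)

text \<open>
  A subscript acts on the coefficients from the left and commutes with \<open>\<partial>\<close>, so that \<open>\<partial>\<close> may be applied before or
  after the substitution.
\<close>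

lemma subst_var_Del:
  assumes "commuting T"
  shows "subst_var T (map_poly (dd act) p) = Del act (subst_var T p)"
proof (induction p)
  case 0
  then show ?case
    using assms by (simp add: additive.zero[OF additive_subst_var] commuting_def Del_additive)
next
  case (pCons a p)
  then show ?case
    using assms unfolding commuting_def
    by (simp add: map_poly_pCons additive.zero[OF additive_dd] subst_var_pCons Del_additive Del_Const)
qed

lemma commuting_funpow:
  assumes "commuting T"
  shows "T ((Lam ^^ n) X) = (Lam ^^ n) (T X)" "T ((Mu ^^ n) X) = (Mu ^^ n) (T X)"
  by (induction n; use assms in \<open>simp add: commuting_def\<close>)+

lemma commuting_Del: "commuting (Del act)"
  by (simp add: commuting_def additive_Del Del_Lam Del_Mu)

lemma coeff_coeff_Del: "coeff (coeff (Del act X) i) j = dd act (coeff (coeff X i) j)"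
  by (simp add: Del_def coeff_map_poly additive.zero[OF additive_dd])

lemma Del_bound:
  assumes "degree X \<le> N" "\<And>i. degree (coeff X i) \<le> N"
  shows "degree (Del act X) \<le> N" "degree (coeff (Del act X) i) \<le> N"
  using assms
  by (auto simp: Del_def coeff_map_poly additive.zero[OF additive_dd] intro: order_trans[OF map_poly_degree_leq])

context
  fixes P T
  assumes P: "lambda_product act P" and T: "commuting T"
begin

lemma lambda_product_biadditive: "biadditive P" and commuting_additive: "additive T"
  using P T by (auto simp: lambda_product_imp_biadditive commuting_def)

lemma subst_var_dd_left: "subst_var T (P (dd act a) b) = - T (subst_var T (P a b))"
  using P unfolding lambda_product_def
  by (simp add: additive.minus[OF additive_subst_var] additive.minus commuting_additive subst_var_pCons Const_additive)

lemma subst_var_dd_right: "subst_var T (P a (dd act b)) = T (subst_var T (P a b)) + Del act (subst_var T (P a b))"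
  using P unfolding lambda_product_def
  by (simp add: additive.add[OF additive_subst_var] commuting_additive subst_var_pCons Const_additive subst_var_Del T)

text \<open>
  Conformal sesquilinearity survives the extension to arguments with coefficients in \<open>\<lambda>\<close> and \<open>\<mu>\<close> and the
  substitution of an operator \<open>T\<close> for the variable: a \<open>\<partial>\<close> on the left becomes \<open>-T\<close>, a \<open>\<partial>\<close> on the right becomes
  \<open>T + \<partial>\<close>. With these two rules every nested product of elements of \<open>A\<close> becomes an explicit polynomial in
  \<open>\<lambda>\<close>, \<open>\<mu>\<close>, \<open>\<partial>\<close>.
\<close>

lemma prod_at_Del_left: "Del act X \<star>[P, T] Y = - T (X \<star>[P, T] Y)"
proof -
  obtain N where N: "degree X \<le> N" "\<And>i. degree (coeff X i) \<le> N" "degree Y \<le> N" "\<And>i. degree (coeff Y i) \<le> N"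
    using poly_poly_bound2 by blast
  show ?thesis
    unfolding prod_at_bound[OF commuting_additive lambda_product_biadditive N]
      prod_at_bound[OF commuting_additive lambda_product_biadditive Del_bound[OF N(1,2)] N(3,4)]
    by (simp only: coeff_coeff_Del subst_var_dd_left commuting_funpow[OF T, symmetric]
        additive.minus[OF additive_funpow[OF additive_Lam]] additive.minus[OF additive_funpow[OF additive_Mu]]
        additive.sum[OF commuting_additive] sum_negf)
qed

lemma prod_at_Del_right: "X \<star>[P, T] Del act Y = T (X \<star>[P, T] Y) + Del act (X \<star>[P, T] Y)"
proof -
  obtain N where N: "degree X \<le> N" "\<And>i. degree (coeff X i) \<le> N" "degree Y \<le> N" "\<And>i. degree (coeff Y i) \<le> N"
    using poly_poly_bound2 by blast
  show ?thesis
    unfolding prod_at_bound[OF commuting_additive lambda_product_biadditive N]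
      prod_at_bound[OF commuting_additive lambda_product_biadditive N(1,2) Del_bound[OF N(3,4)]]
    by (simp only: coeff_coeff_Del subst_var_dd_right commuting_funpow[OF T, symmetric]
        commuting_funpow[OF commuting_Del, symmetric]
        additive.add[OF additive_funpow[OF additive_Lam]] additive.add[OF additive_funpow[OF additive_Mu]]
        additive.sum[OF commuting_additive] additive.sum[OF additive_Del] sum.distrib)
qed

lemmas prod_at_additive = biadditiveD[OF biadditive_prod_at[OF commuting_additive lambda_product_biadditive]]

lemmas prod_at_Lam_Mu =
  prod_at_Lam_left[OF commuting_additive lambda_product_biadditive]
  prod_at_Lam_right[OF commuting_additive lambda_product_biadditive]
  prod_at_Mu_left[OF commuting_additive lambda_product_biadditive]
  prod_at_Mu_right[OF commuting_additive lambda_product_biadditive]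

lemmas prod_at_simps = prod_at_additive prod_at_Lam_Mu prod_at_Del_left prod_at_Del_right

end

end

section \<open>The module \<open>R(A)\<close>\<close>

text \<open>
  \<open>R(A)\<close> is generated by \<open>A\<close> under addition and \<open>\<partial>\<close>.
\<close>

lemma poly_induct_add [case_names const shift add]:
  assumes "\<And>a. P [:a:]" "\<And>u. P u \<Longrightarrow> P (pCons 0 u)" "\<And>u v. P u \<Longrightarrow> P v \<Longrightarrow> P (u + v)"
  shows "P (u :: 'a::ab_group_add poly)"
proof (induction u)
  case 0
  then show ?case using assms(1)[of 0] by simp
next
  case (pCons a u)
  have "P ([:a:] + pCons 0 u)" by (intro assms pCons)
  then show ?case by simp
qed

text \<open>
  The module action on \<open>R(A)\<close> and the sesquilinear extension of a product are both sums of this form.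
\<close>

lemma double_sum_bound:
  fixes F :: "nat \<Rightarrow> nat \<Rightarrow> 'a::ab_group_add \<Rightarrow> 'b::ab_group_add \<Rightarrow> 'c::ab_group_add"
  assumes F: "\<And>i j. biadditive (F i j)" and "degree p \<le> M" "degree q \<le> N"
  shows "(\<Sum>i\<le>degree p. \<Sum>j\<le>degree q. F i j (coeff p i) (coeff q j)) =
    (\<Sum>i\<le>M. \<Sum>j\<le>N. F i j (coeff p i) (coeff q j))"
  using assms(2,3)
  by (intro sum.mono_neutral_cong_left) (auto simp: coeff_eq_0 biadditiveD(3,4)[OF F])

lemma biadditive_double_sum:
  fixes F :: "nat \<Rightarrow> nat \<Rightarrow> 'a::ab_group_add \<Rightarrow> 'b::ab_group_add \<Rightarrow> 'c::ab_group_add"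
  assumes F: "\<And>i j. biadditive (F i j)"
  shows "biadditive (\<lambda>p q. \<Sum>i\<le>degree p. \<Sum>j\<le>degree q. F i j (coeff p i) (coeff q j))"
proof (rule biadditiveI)
  fix p p' :: "'a poly" and q :: "'b poly"
  let ?M = "max (degree p) (degree p')"
  have d: "degree p \<le> ?M" "degree p' \<le> ?M" "degree (p + p') \<le> ?M" by (auto intro: degree_add_le)
  show "(\<Sum>i\<le>degree (p + p'). \<Sum>j\<le>degree q. F i j (coeff (p + p') i) (coeff q j)) =
    (\<Sum>i\<le>degree p. \<Sum>j\<le>degree q. F i j (coeff p i) (coeff q j)) +
    (\<Sum>i\<le>degree p'. \<Sum>j\<le>degree q. F i j (coeff p' i) (coeff q j))"
    unfolding double_sum_bound[OF F d(1) order_refl] double_sum_bound[OF F d(2) order_refl]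
      double_sum_bound[OF F d(3) order_refl]
    by (simp add: biadditiveD(1)[OF F] sum.distrib)
next
  fix p :: "'a poly" and q q' :: "'b poly"
  let ?M = "max (degree q) (degree q')"
  have d: "degree q \<le> ?M" "degree q' \<le> ?M" "degree (q + q') \<le> ?M" by (auto intro: degree_add_le)
  show "(\<Sum>i\<le>degree p. \<Sum>j\<le>degree (q + q'). F i j (coeff p i) (coeff (q + q') j)) =
    (\<Sum>i\<le>degree p. \<Sum>j\<le>degree q. F i j (coeff p i) (coeff q j)) +
    (\<Sum>i\<le>degree p. \<Sum>j\<le>degree q'. F i j (coeff p i) (coeff q' j))"
    unfolding double_sum_bound[OF F order_refl d(1)] double_sum_bound[OF F order_refl d(2)]
      double_sum_bound[OF F order_refl d(3)]
    by (simp add: biadditiveD(2)[OF F] sum.distrib)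
qed

locale vector_space_char_0 = vector_space scale
  for scale :: "'k::field_char_0 \<Rightarrow> 'a::ab_group_add \<Rightarrow> 'a"
begin

lemma biadditive_RA_act: "biadditive (RA_act scale)"
proof -
  have "biadditive (\<lambda>x y. monom (scale x y) (i + j))" for i j
    by (intro biadditiveI) (simp_all add: scale_left_distrib scale_right_distrib add_monom)
  from biadditive_double_sum[of "\<lambda>i j x y. monom (scale x y) (i + j)", OF this]
  show ?thesis by (simp add: RA_act_def[abs_def])
qed

lemma RA_act_const: "RA_act scale [:c:] u = map_poly (scale c) u"
proof -
  have "coeff (RA_act scale [:c:] u) n = scale c (coeff u n)" for n
  proof -
    have "coeff (RA_act scale [:c:] u) n = (\<Sum>j\<le>degree u. if j = n then scale c (coeff u j) else 0)"
      by (simp add: RA_act_def coeff_sum)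
    also have "\<dots> = scale c (coeff u n)" by (simp add: coeff_eq_0)
    finally show ?thesis .
  qed
  then show ?thesis by (intro poly_eqI) (simp add: coeff_map_poly)
qed

lemma RA_act_pCons_0: "RA_act scale (pCons 0 p) u = pCons 0 (RA_act scale p u)"
proof (cases "p = 0")
  case True
  then show ?thesis by (simp add: RA_act_def)
next
  case False
  then have "RA_act scale (pCons 0 p) u =
      (\<Sum>i\<le>degree p. \<Sum>j\<le>degree u. pCons 0 (monom (scale (coeff p i) (coeff u j)) (i + j)))"
    unfolding RA_act_def
    by (simp only: degree_pCons_eq simp_thms) (subst sum.atMost_Suc_shift, simp add: monom_Suc)
  then show ?thesis by (simp add: RA_act_def additive.sum[OF additive_pCons_0])
qed

lemma map_poly_scale_one: "map_poly (scale 1) u = u"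
  by (rule poly_eqI) (simp add: coeff_map_poly)

lemma dd_RA_act: "dd (RA_act scale) = pCons 0"
  by (rule ext) (simp add: dd_def RA_act_pCons_0 RA_act_const map_poly_scale_one)

lemma kscale_RA_act: "kscale (RA_act scale) c = map_poly (scale c)"
  by (rule ext) (simp add: kscale_def RA_act_const)

lemma conformal_module_RA_act: "conformal_module (RA_act scale)"
proof -
  note add = biadditiveD(1,2)[OF biadditive_RA_act]
  have const: "RA_act scale [:c:] (RA_act scale q u) = RA_act scale (smult c q) u" for c q u
  proof (induction q rule: poly_induct_add)
    case (const a)
    show ?case by (simp add: RA_act_const map_poly_map_poly o_def)
  next
    case (shift q)
    then show ?case by (simp add: RA_act_pCons_0 RA_act_const map_poly_pCons)
  next
    case (add q r)
    then show ?case by (simp add: biadditiveD(1,2)[OF biadditive_RA_act] smult_add_right)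
  qed
  show ?thesis
  proof
    fix p q :: "'k poly" and u v :: "'a poly"
    show "RA_act scale p (u + v) = RA_act scale p u + RA_act scale p v"
      "RA_act scale (p + q) u = RA_act scale p u + RA_act scale q u"
      by (rule add)+
    show "RA_act scale p (RA_act scale q u) = RA_act scale (p * q) u"
      by (induction p rule: poly_induct_add) (simp_all add: const RA_act_pCons_0 add algebra_simps)
    show "RA_act scale 1 u = u"
      using RA_act_const[of 1 u] by (simp add: one_pCons map_poly_scale_one)
  qed
qed

end

lemma (in vector_space) vector_space_map_poly: "vector_space (\<lambda>c. map_poly (scale c))"
  by unfold_locales (auto intro!: poly_eqI simp: coeff_map_poly scale_left_distrib scale_right_distrib)

lemma (in conformal_module) vector_space_kscale: "vector_space (kscale act)"
proof
  fix a b and x y :: 'm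
  show "kscale act a (x + y) = kscale act a x + kscale act a y"
    by (simp add: kscale_def scale_right_distrib)
  show "kscale act (a + b) x = kscale act a x + kscale act b x"
    using scale_left_distrib[of "[:a:]" "[:b:]" x] by (simp add: kscale_def)
  show "kscale act a (kscale act b x) = kscale act (a * b) x"
    using scale_scale[of "[:a:]" "[:b:]" x] by (simp add: kscale_def mult.commute)
  show "kscale act 1 x = x"
    using scale_one[of x] by (simp add: kscale_def one_pCons)
qed

section \<open>The sesquilinear extension of a product\<close>

lemma additive_neg_lambda: "additive (\<lambda>q :: 'a::ab_group_add poly poly. - pCons 0 q)"
  by (simp add: additive_def)

lemma additive_lambda_plus_del:
  "additive (\<lambda>q :: 'a::ab_group_add poly poly. pCons 0 q + map_poly (pCons 0) q)"
  by (simp add: additive_def additive.add[OF additive_pCons_0]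
      additive.add[OF additive_map_poly[OF additive_pCons_0]] ac_simps del: add_pCons)

lemma biadditive_sesquilinear_ext:
  assumes "biadditive f"
  shows "biadditive (sesquilinear_ext f)"
proof -
  have "biadditive (\<lambda>x y. ((\<lambda>q. - pCons 0 q) ^^ i) (((\<lambda>q. pCons 0 q + map_poly (pCons 0) q) ^^ j) (f x y)))" for i j
    by (intro biadditiveI)
       (simp_all only: biadditiveD(1,2)[OF assms] additive.add[OF additive_funpow[OF additive_neg_lambda]]
         additive.add[OF additive_funpow[OF additive_lambda_plus_del]])
  from biadditive_double_sum[of "\<lambda>i j x y. ((\<lambda>q. - pCons 0 q) ^^ i) (((\<lambda>q. pCons 0 q + map_poly (pCons 0) q) ^^ j) (f x y))", OF this]
  show ?thesis by (simp add: sesquilinear_ext_def[abs_def])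
qed

lemma sesquilinear_ext_const: "sesquilinear_ext f [:a:] [:b:] = f a b"
  by (simp add: sesquilinear_ext_def)

lemma sesquilinear_ext_dd_left:
  assumes f: "biadditive f"
  shows "sesquilinear_ext f (pCons 0 u) v = - pCons 0 (sesquilinear_ext f u v)"
proof (cases "u = 0")
  case True
  then show ?thesis by (simp add: biadditiveD(3)[OF biadditive_sesquilinear_ext[OF f]])
next
  case False
  define A where "A = (\<lambda>q :: 'a poly poly. - pCons 0 q)"
  have A: "additive A" unfolding A_def by (rule additive_neg_lambda)
  note z = biadditiveD(3)[OF f] additive.zero[OF additive_funpow[OF additive_lambda_plus_del]]
    additive.zero[OF additive_funpow[OF A]]
  have "sesquilinear_ext f (pCons 0 u) v = A (sesquilinear_ext f u v)"
    using False unfolding sesquilinear_ext_def A_def[symmetric]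
    by (simp only: degree_pCons_eq simp_thms)
       (subst sum.atMost_Suc_shift, simp add: z additive.sum[OF A])
  then show ?thesis by (simp add: A_def)
qed

lemma sesquilinear_ext_dd_right:
  assumes f: "biadditive f"
  shows "sesquilinear_ext f u (pCons 0 v) =
    pCons 0 (sesquilinear_ext f u v) + map_poly (pCons 0) (sesquilinear_ext f u v)"
proof (cases "v = 0")
  case True
  then show ?thesis by (simp add: biadditiveD(4)[OF biadditive_sesquilinear_ext[OF f]])
next
  case False
  define A where "A = (\<lambda>q :: 'a poly poly. - pCons 0 q)"
  define B where "B = (\<lambda>q :: 'a poly poly. pCons 0 q + map_poly (pCons 0) q)"
  have A: "additive A" unfolding A_def by (rule additive_neg_lambda)
  have B: "additive B" unfolding B_def by (rule additive_lambda_plus_del)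
  have AB: "(A ^^ n) (B q) = B ((A ^^ n) q)" for n q
    by (induction n)
       (simp_all add: A_def B_def map_poly_pCons additive.minus[OF additive_map_poly[OF additive_pCons_0]])
  note z = biadditiveD(4)[OF f] additive.zero[OF additive_funpow[OF A]] additive.zero[OF additive_funpow[OF B]]
    additive.add[OF additive_funpow[OF A]] additive.sum[OF additive_funpow[OF A]]
  have "sesquilinear_ext f u (pCons 0 v) = B (sesquilinear_ext f u v)"
    using False unfolding sesquilinear_ext_def A_def[symmetric] B_def[symmetric]
    by (simp only: degree_pCons_eq simp_thms)
       (subst sum.atMost_Suc_shift, simp add: z additive.sum[OF B] AB)
  then show ?thesis by (simp add: B_def)
qed

context vector_space_char_0
begin

sublocale RA: conformal_module "RA_act scale"
  by (rule conformal_module_RA_act)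

text \<open>
  \<open>J\<close> embeds \<open>A\<close> into \<open>R(A)[\<lambda>,\<mu>]\<close>.
\<close>

abbreviation J :: "'a \<Rightarrow> 'a poly poly poly"
  where "J a \<equiv> \<iota> [:a:]"

lemma RA_product_biadditive:
  assumes f: "biadditive f" and g: "biadditive g"
  shows "biadditive (\<lambda>a b. monom (monom (f b a) 1) 0 + monom (monom (g a b + f b a) 0) 1)"
  by (intro biadditiveI)
    (simp_all add: biadditiveD(1,2)[OF f] biadditiveD(1,2)[OF g] add_monom[symmetric] algebra_simps)

lemma RA_product_const: "RA_product f g [:a:] [:b:] = [:[:0, f b a:], [:g a b + f b a:]:]"
  by (simp add: RA_product_def sesquilinear_ext_const monom_Suc monom_0)

lemma bilinear_map_scale:
  assumes "bilinear_map scale scale f"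
  shows "f (scale c x) y = scale c (f x y)" "f x (scale c y) = scale c (f x y)"
  using assms by (auto simp: bilinear_map_def Vector_Spaces.linear_def module_hom_iff)

text \<open>
  Compatibility with \<open>\<partial>\<close> is part of the construction of the extension. Compatibility with scalars is clear on \<open>A\<close>
  and passes to \<open>R(A)\<close>, one argument after the other, because scalars commute with \<open>\<lambda>\<close> and \<open>\<partial>\<close>.
\<close>

lemma lambda_product_RA_product:
  assumes "bilinear_map scale scale f" "bilinear_map scale scale g"
  shows "lambda_product (RA_act scale) (RA_product f g)"
proof -
  have f: "biadditive f" and g: "biadditive g" using assms bilinear_map_imp_biadditive by blast+
  note h = RA_product_biadditive[OF f g]
  define P where "P = RA_product f g"
  have P: "biadditive P" unfolding P_def RA_product_def by (rule biadditive_sesquilinear_ext[OF h])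
  have l: "P (pCons 0 u) v = - pCons 0 (P u v)" for u v
    unfolding P_def RA_product_def by (rule sesquilinear_ext_dd_left[OF h])
  have r: "P u (pCons 0 v) = pCons 0 (P u v) + map_poly (pCons 0) (P u v)" for u v
    unfolding P_def RA_product_def by (rule sesquilinear_ext_dd_right[OF h])
  define S where "S c = map_poly (scale c)" for c
  have S: "additive (S c)" for c
    unfolding S_def by (intro additive_map_poly) (simp add: additive_def scale_right_distrib)
  have SS: "additive (map_poly (S c))" for c
    by (intro additive_map_poly S)
  have Sp: "S c (pCons x u) = pCons (scale c x) (S c u)" for c x u
    by (simp add: S_def map_poly_pCons)
  have SSp: "map_poly (S c) (pCons x u) = pCons (S c x) (map_poly (S c) u)" for c x u
    by (simp add: map_poly_pCons additive.zero[OF S])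
  have SSd: "map_poly (S c) (map_poly (pCons 0) u) = map_poly (pCons 0) (map_poly (S c) u)" for c u
    by (intro poly_eqI) (simp add: coeff_map_poly additive.zero[OF S] Sp)
  note sc = bilinear_map_scale[OF assms(1)] bilinear_map_scale[OF assms(2)]
  note ad = additive.add[OF S] additive.add[OF SS] additive.minus[OF SS] additive.zero[OF S] additive.zero[OF SS] biadditiveD(1,2)[OF P]
  \<comment> \<open>the scalar \<open>c\<close> is moved out on constants first, then with a general right argument, then in general\<close>
  have cc: "P (S c [:a:]) [:b:] = map_poly (S c) (P [:a:] [:b:])"
    "P [:a:] (S c [:b:]) = map_poly (S c) (P [:a:] [:b:])" for c a b
    by (simp_all add: Sp SSp ad P_def RA_product_const sc scale_right_distrib)
  have cl: "P (S c [:a:]) v = map_poly (S c) (P [:a:] v)" for c a v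
    by (induction v rule: poly_induct_add) (simp_all only: cc r ad SSp SSd)
  have cr: "P [:a:] (S c v) = map_poly (S c) (P [:a:] v)" for c a v
    by (induction v rule: poly_induct_add) (simp_all only: cc cc(2)[unfolded Sp additive.zero[OF S]] r ad SSp SSd Sp scale_zero_right)
  have sl: "P (S c u) v = map_poly (S c) (P u v)" for c u v
    by (induction u rule: poly_induct_add) (simp_all only: cl cl[unfolded Sp additive.zero[OF S]] l ad SSp Sp scale_zero_right)
  have sr: "P u (S c v) = map_poly (S c) (P u v)" for c u v
    by (induction u rule: poly_induct_add) (simp_all only: cr l ad SSp)
  have ks: "kscale (RA_act scale) = S" by (rule ext) (simp add: kscale_RA_act S_def)
  have v1: "vector_space S" using RA.vector_space_kscale by (simp add: ks)
  have v2: "vector_space (\<lambda>c. map_poly (S c))" by (rule vector_space.vector_space_map_poly[OF v1])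
  have "bilinear_map S (\<lambda>c. map_poly (S c)) P"
    using v1 v2 by (simp add: bilinear_map_def Vector_Spaces.linear_def module_hom_iff vector_space_def module_def ad sl sr)
  then show ?thesis
    unfolding lambda_product_def P_def[symmetric] ks dd_RA_act by (simp add: l r)
qed

text \<open>
  Products of elements of \<open>A\<close> have degree one in the subscript and \<open>\<partial>\<close>.
\<close>

lemma prod_at_RA_product:
  assumes f: "bilinear_map scale scale f" and g: "bilinear_map scale scale g"
    and T: "RA.commuting T"
  shows "J a \<star>[RA_product f g, T] J b = Del (RA_act scale) (J (f b a)) + T (J (g a b)) + T (J (f b a))"
proof -
  have P: "biadditive (RA_product f g)"
    using lambda_product_RA_product[OF f g] by (rule lambda_product_imp_biadditive)
  have T': "additive T" using T by (simp add: RA.commuting_def)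
  have J: "\<iota> [:x + y:] = J x + J y" for x y :: 'a
    by (simp add: Const_def)
  show ?thesis
    by (simp del: pCons_eq_0_iff add: prod_at_Const[OF T' P] RA_product_const subst_var_pCons[OF T'] additive.add[OF T']
      additive.zero[OF additive_subst_var[OF T']] RA.Del_Const dd_RA_act Const_additive J additive.zero[OF T'])
qed

end

section \<open>Defects of the conformal identities\<close>

context conformal_module
begin

text \<open>
  This is the behaviour of \<open>a *\<^sub>\<lambda> (b *\<^sub>\<mu> c)\<close> under addition and \<open>\<partial>\<close>. The other bracketings and orders that occur in the
  identities have the same behaviour, since their subscripts are chosen such that the \<open>\<partial>\<close>-weights of \<open>a\<close>, \<open>b\<close>
  and \<open>c\<close> are \<open>-\<lambda>\<close>, \<open>-\<mu>\<close> and \<open>\<lambda> + \<mu> + \<partial>\<close>.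
\<close>

definition conformal_trilinear :: "('m \<Rightarrow> 'm \<Rightarrow> 'm \<Rightarrow> 'm poly poly) \<Rightarrow> bool"
  where "conformal_trilinear E \<longleftrightarrow>
    (\<forall>a a' b c. E (a + a') b c = E a b c + E a' b c) \<and>
    (\<forall>a b b' c. E a (b + b') c = E a b c + E a b' c) \<and>
    (\<forall>a b c c'. E a b (c + c') = E a b c + E a b c') \<and>
    (\<forall>a b c. E (dd act a) b c = - Lam (E a b c)) \<and>
    (\<forall>a b c. E a (dd act b) c = - Mu (E a b c)) \<and>
    (\<forall>a b c. E a b (dd act c) = Lam (E a b c) + Mu (E a b c) + Del act (E a b c))"

text \<open>
  A defect is the difference of the two sides of an identity.
\<close>

definition Jacobi_defect :: "('m \<Rightarrow> 'm \<Rightarrow> 'm poly) \<Rightarrow> 'm \<Rightarrow> 'm \<Rightarrow> 'm \<Rightarrow> 'm poly poly"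
  where "Jacobi_defect br a b c =
    \<iota> a \<star>[br, Lam] (\<iota> b \<star>[br, Mu] \<iota> c) -
    ((\<iota> a \<star>[br, Lam] \<iota> b) \<star>[br, LamMu] \<iota> c + \<iota> b \<star>[br, Mu] (\<iota> a \<star>[br, Lam] \<iota> c))"

definition ppp_Lie_1_defect :: "('m \<Rightarrow> 'm \<Rightarrow> 'm poly) \<Rightarrow> ('m \<Rightarrow> 'm \<Rightarrow> 'm poly) \<Rightarrow> 'm \<Rightarrow> 'm \<Rightarrow> 'm \<Rightarrow> 'm poly poly"
  where "ppp_Lie_1_defect br lh a b c =
    \<iota> a \<star>[lh, Lam] (\<iota> b \<star>[br, Mu] \<iota> c) -
    ((\<iota> a \<star>[br, Lam] \<iota> b) \<star>[lh, LamMu] \<iota> c - (\<iota> a \<star>[br, Lam] \<iota> c) \<star>[lh, MuDel act] \<iota> b)"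

definition ppp_Lie_2_defect :: "('m \<Rightarrow> 'm \<Rightarrow> 'm poly) \<Rightarrow> ('m \<Rightarrow> 'm \<Rightarrow> 'm poly) \<Rightarrow> 'm \<Rightarrow> 'm \<Rightarrow> 'm \<Rightarrow> 'm poly poly"
  where "ppp_Lie_2_defect br lh a b c =
    \<iota> a \<star>[br, Lam] (\<iota> b \<star>[lh, Mu] \<iota> c + \<iota> c \<star>[lh, MuDel act] \<iota> b) -
    ((\<iota> a \<star>[br, Lam] \<iota> c) \<star>[lh, MuDel act] \<iota> b + \<iota> b \<star>[lh, Mu] (\<iota> a \<star>[br, Lam] \<iota> c))"

definition ppp_Lie_3_defect :: "('m \<Rightarrow> 'm \<Rightarrow> 'm poly) \<Rightarrow> ('m \<Rightarrow> 'm \<Rightarrow> 'm poly) \<Rightarrow> ('m \<Rightarrow> 'm \<Rightarrow> 'm poly) \<Rightarrow>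
    'm \<Rightarrow> 'm \<Rightarrow> 'm \<Rightarrow> 'm poly poly"
  where "ppp_Lie_3_defect br lh rh a b c =
    \<iota> a \<star>[rh, Lam] (\<iota> b \<star>[br, Mu] \<iota> c) - (\<iota> b \<star>[br, Mu] \<iota> c) \<star>[lh, LamDel act] \<iota> a -
    ((\<iota> a \<star>[rh, Lam] \<iota> b + \<iota> a \<star>[lh, Lam] \<iota> b) \<star>[br, LamMu] \<iota> c
       + \<iota> b \<star>[br, Mu] (\<iota> a \<star>[rh, Lam] \<iota> c - \<iota> c \<star>[lh, LamDel act] \<iota> a))"

definition ppp_Lie_4_defect :: "('m \<Rightarrow> 'm \<Rightarrow> 'm poly) \<Rightarrow> ('m \<Rightarrow> 'm \<Rightarrow> 'm poly) \<Rightarrow> ('m \<Rightarrow> 'm \<Rightarrow> 'm poly) \<Rightarrow>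
    'm \<Rightarrow> 'm \<Rightarrow> 'm \<Rightarrow> 'm poly poly"
  where "ppp_Lie_4_defect br lh rh a b c =
    curly act br lh rh a b \<star>[rh, LamMu] \<iota> c -
    (\<iota> a \<star>[rh, Lam] (\<iota> b \<star>[rh, Mu] \<iota> c) - \<iota> b \<star>[rh, Mu] (\<iota> a \<star>[rh, Lam] \<iota> c)
       + \<iota> b \<star>[br, Mu] (\<iota> a \<star>[lh, Lam] \<iota> c) - \<iota> a \<star>[br, Lam] (\<iota> b \<star>[lh, Mu] \<iota> c)
       - (\<iota> a \<star>[br, Lam] \<iota> b) \<star>[lh, LamMu] \<iota> c)"

definition ppp_Lie_5_defect :: "('m \<Rightarrow> 'm \<Rightarrow> 'm poly) \<Rightarrow> ('m \<Rightarrow> 'm \<Rightarrow> 'm poly) \<Rightarrow> ('m \<Rightarrow> 'm \<Rightarrow> 'm poly) \<Rightarrow>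
    'm \<Rightarrow> 'm \<Rightarrow> 'm \<Rightarrow> 'm poly poly"
  where "ppp_Lie_5_defect br lh rh a b c =
    (\<iota> a \<star>[rh, Lam] \<iota> b - \<iota> b \<star>[lh, Mu] \<iota> a) \<star>[lh, LamMu] \<iota> c
       + \<iota> b \<star>[lh, Mu] (\<iota> a \<star>[rh, Lam] \<iota> c + \<iota> a \<star>[lh, Lam] \<iota> c) -
    (\<iota> a \<star>[rh, Lam] (\<iota> b \<star>[lh, Mu] \<iota> c) + \<iota> a \<star>[br, Lam] (\<iota> b \<star>[lh, Mu] \<iota> c))"

definition skew_defect :: "('m \<Rightarrow> 'm \<Rightarrow> 'm poly) \<Rightarrow> 'm \<Rightarrow> 'm \<Rightarrow> 'm poly poly"
  where "skew_defect P a b = \<iota> a \<star>[P, Lam] \<iota> b - (- (\<iota> b \<star>[P, LamDel act] \<iota> a))"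

lemma conformal_trilinear_defects:
  assumes br: "lambda_product act br" and lh: "lambda_product act lh" and rh: "lambda_product act rh"
  shows "conformal_trilinear (Jacobi_defect br)"
    "conformal_trilinear (ppp_Lie_1_defect br lh)"
    "conformal_trilinear (ppp_Lie_2_defect br lh)"
    "conformal_trilinear (ppp_Lie_3_defect br lh rh)"
    "conformal_trilinear (ppp_Lie_4_defect br lh rh)"
    "conformal_trilinear (ppp_Lie_5_defect br lh rh)"
  unfolding conformal_trilinear_def Jacobi_defect_def ppp_Lie_1_defect_def ppp_Lie_2_defect_def ppp_Lie_3_defect_def ppp_Lie_4_defect_def
    ppp_Lie_5_defect_def curly_def
  by (simp_all add: Const_additive Del_Const[symmetric] prod_at_simps[OF br] prod_at_simps[OF lh]
      prod_at_simps[OF rh] operator_simps algebra_simps)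

lemma skew_defect_conformal:
  assumes P: "lambda_product act P"
  shows "skew_defect P (a + a') b = skew_defect P a b + skew_defect P a' b"
    "skew_defect P a (b + b') = skew_defect P a b + skew_defect P a b'"
    "skew_defect P (dd act a) b = - Lam (skew_defect P a b)"
    "skew_defect P a (dd act b) = Lam (skew_defect P a b) + Del act (skew_defect P a b)"
  unfolding skew_defect_def
  by (simp_all add: Const_additive Del_Const[symmetric] prod_at_simps[OF P] operator_simps algebra_simps)

end

context vector_space_char_0
begin

text \<open>
  A defect that vanishes on \<open>A\<close> vanishes on \<open>R(A)\<close>: its zeros in each argument are closed under addition and
  \<open>\<partial>\<close>. The identities therefore need to be compared on \<open>A\<close> only.
\<close>

lemma conformal_trilinear_vanishes:
  assumes E: "RA.conformal_trilinear E" and "\<And>a b c. E [:a:] [:b:] [:c:] = 0"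
  shows "E u v w = 0"
proof -
  note r = E[unfolded RA.conformal_trilinear_def dd_RA_act] RA.operator_simps
  have 1: "E [:a:] [:b:] w = 0" for a b w
    by (induction w rule: poly_induct_add) (simp_all add: r assms(2))
  have 2: "E [:a:] v w = 0" for a v w
    by (induction v rule: poly_induct_add) (simp_all add: r 1)
  show ?thesis
    by (induction u rule: poly_induct_add) (simp_all add: r 2)
qed

lemma skew_defect_vanishes:
  assumes P: "lambda_product (RA_act scale) P" and "\<And>a b. RA.skew_defect P [:a:] [:b:] = 0"
  shows "RA.skew_defect P u v = 0"
proof -
  note r = RA.skew_defect_conformal[OF P, unfolded dd_RA_act] RA.operator_simps
  have 1: "RA.skew_defect P [:a:] v = 0" for a v
    by (induction v rule: poly_induct_add) (simp_all add: r assms(2))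
  show ?thesis
    by (induction u rule: poly_induct_add) (simp_all add: r 1)
qed

lemma additive_J: "additive J"
  by (simp add: additive_def Const_def)

section \<open>Quadratic forms in \<open>\<lambda>\<close>, \<open>\<mu>\<close>, \<open>\<partial>\<close>\<close>

text \<open>
  The quadratic form in \<open>\<lambda>\<close>, \<open>\<mu>\<close>, \<open>\<partial>\<close> with coefficients in \<open>A\<close> that takes the values \<open>p\<close>, \<open>q\<close>, \<open>r\<close>, \<open>s\<close>, \<open>t\<close>, \<open>u\<close> at the
  points \<open>(1,0,0)\<close>, \<open>(0,1,0)\<close>, \<open>(0,0,1)\<close>, \<open>(1,-1,0)\<close>, \<open>(1,0,-1)\<close>, \<open>(0,1,-1)\<close>. For instance, the value at \<open>(1,-1,0)\<close>
  is \<open>p + q\<close> minus the coefficient of \<open>\<lambda>\<mu>\<close>, which is therefore \<open>p + q - s\<close>. At the last three points one of \<open>\<lambda> + \<mu>\<close>, \<open>\<lambda> + \<partial>\<close>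
  and \<open>\<mu> + \<partial>\<close> vanishes, so that the values of the defects there have far fewer terms than their mixed coefficients.
\<close>

definition quadratic :: "'a \<Rightarrow> 'a \<Rightarrow> 'a \<Rightarrow> 'a \<Rightarrow> 'a \<Rightarrow> 'a \<Rightarrow> 'a poly poly poly"
  where "quadratic p q r s t u =
    Lam (Lam (J p)) + Mu (Mu (J q)) + Del (RA_act scale) (Del (RA_act scale) (J r)) +
    Lam (Mu (J (p + q - s))) + Lam (Del (RA_act scale) (J (p + r - t))) + Mu (Del (RA_act scale) (J (q + r - u)))"

lemma quadratic_eq_0_iff:
  "quadratic p q r s t u = 0 \<longleftrightarrow> p = 0 \<and> q = 0 \<and> r = 0 \<and> s = 0 \<and> t = 0 \<and> u = 0"
proof -
  have "quadratic p q r s t u =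
    [:[:[:0, 0, r:], [:0, q + r - u:], [:q:]:], [:[:0, p + r - t:], [:p + q - s:]:], [:[:p:]:]:]"
    unfolding quadratic_def Lam_def Mu_def Del_def Const_def dd_RA_act
    by (simp add: map_poly_pCons del: pCons_eq_0_iff)
  then show ?thesis by auto
qed

lemmas J_additive =
  additive.add[OF additive_J] additive.zero[OF additive_J]
  additive.minus[OF additive_J] additive.diff[OF additive_J]

end

section \<open>The defects on \<open>A\<close>\<close>

locale five_products = vector_space_char_0 scale
  for scale :: "'k::field_char_0 \<Rightarrow> 'a::ab_group_add \<Rightarrow> 'a" +
  fixes mul :: "'a \<Rightarrow> 'a \<Rightarrow> 'a" (infixl "\<cdot>" 70)
    and ne :: "'a \<Rightarrow> 'a \<Rightarrow> 'a" (infixl "\<nearrow>" 70)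
    and se :: "'a \<Rightarrow> 'a \<Rightarrow> 'a" (infixl "\<searrow>" 70)
    and nw :: "'a \<Rightarrow> 'a \<Rightarrow> 'a" (infixl "\<nwarrow>" 70)
    and sw :: "'a \<Rightarrow> 'a \<Rightarrow> 'a" (infixl "\<swarrow>" 70)
  assumes mul: "bilinear_map scale scale mul"
    and ne: "bilinear_map scale scale ne"
    and se: "bilinear_map scale scale se"
    and nw: "bilinear_map scale scale nw"
    and sw: "bilinear_map scale scale sw"
begin

abbreviation mulp :: "'a poly \<Rightarrow> 'a poly \<Rightarrow> 'a poly poly" where "mulp \<equiv> RA_product mul mul"
abbreviation lhp :: "'a poly \<Rightarrow> 'a poly \<Rightarrow> 'a poly poly" where "lhp \<equiv> RA_product se nw"
abbreviation rhp :: "'a poly \<Rightarrow> 'a poly \<Rightarrow> 'a poly poly" where "rhp \<equiv> RA_product ne sw"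
abbreviation star :: "'a \<Rightarrow> 'a \<Rightarrow> 'a"
  where "star a b \<equiv> a \<nwarrow> b + a \<nearrow> b + a \<swarrow> b + a \<searrow> b + a \<cdot> b"

lemmas mulp = lambda_product_RA_product[OF mul mul]
lemmas lhp = lambda_product_RA_product[OF se nw]
lemmas rhp = lambda_product_RA_product[OF ne sw]

lemmas products_additive =
  biadditiveD[OF bilinear_map_imp_biadditive[OF mul]] biadditiveD[OF bilinear_map_imp_biadditive[OF ne]]
  biadditiveD[OF bilinear_map_imp_biadditive[OF se]] biadditiveD[OF bilinear_map_imp_biadditive[OF nw]]
  biadditiveD[OF bilinear_map_imp_biadditive[OF sw]]

lemmas expand =
  prod_at_RA_product[OF mul mul] prod_at_RA_product[OF se nw] prod_at_RA_product[OF ne sw]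
  RA.prod_at_simps[OF mulp] RA.prod_at_simps[OF lhp] RA.prod_at_simps[OF rhp]
  RA.operator_simps J_additive products_additive quadratic_def algebra_simps

text \<open>
  On elements of \<open>A\<close> the two nested products contribute one degree each, so that every defect is a quadratic form.
  Each of its six values is written as a difference in which the two sides of an identity between the five
  operations, in permuted arguments, can be recognized.
\<close>

lemma Jacobi_defect_constants:
  "RA.Jacobi_defect mulp [:a:] [:b:] [:c:] = quadratic
    ((a \<cdot> (c \<cdot> b) + (c \<cdot> b) \<cdot> a)
      - (c \<cdot> (a \<cdot> b) + (a \<cdot> b) \<cdot> c))
    ((c \<cdot> (b \<cdot> a) + (b \<cdot> a) \<cdot> c)
      - (b \<cdot> (c \<cdot> a) + (c \<cdot> a) \<cdot> b))
    (((c \<cdot> b) \<cdot> a) - ((c \<cdot> a) \<cdot> b))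
    ((b \<cdot> (a \<cdot> c) + (a \<cdot> c) \<cdot> b)
      - (a \<cdot> (b \<cdot> c) + (b \<cdot> c) \<cdot> a))
    (((a \<cdot> c) \<cdot> b) - ((a \<cdot> b) \<cdot> c))
    (((b \<cdot> a) \<cdot> c) - ((b \<cdot> c) \<cdot> a))"
  unfolding RA.Jacobi_defect_def
  by (simp add: expand)

lemma ppp_Lie_1_defect_constants:
  "RA.ppp_Lie_1_defect mulp lhp [:a:] [:b:] [:c:] = quadratic
    (((c \<cdot> b) \<searrow> a + a \<nwarrow> (c \<cdot> b))
      - (c \<searrow> (a \<cdot> b) + (a \<cdot> b) \<nwarrow> c))
    ((c \<searrow> (b \<cdot> a) + (b \<cdot> a) \<nwarrow> c)
      - (b \<searrow> (c \<cdot> a) + (c \<cdot> a) \<nwarrow> b))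
    (((c \<cdot> b) \<searrow> a) - ((c \<cdot> a) \<nwarrow> b))
    ((b \<searrow> (a \<cdot> c) + (a \<cdot> c) \<nwarrow> b)
      - ((b \<cdot> c) \<searrow> a + a \<nwarrow> (b \<cdot> c)))
    (((a \<cdot> c) \<nwarrow> b) - ((a \<cdot> b) \<nwarrow> c))
    (((b \<cdot> a) \<nwarrow> c) - ((b \<cdot> c) \<searrow> a))"
  unfolding RA.ppp_Lie_1_defect_def
  by (simp add: expand)

text \<open>
  The value at \<open>(0,1,-1)\<close> and, given it, the value at \<open>(1,0,0)\<close> say that \<open>\<nwarrow>\<close> and \<open>\<searrow>\<close> agree inside \<open>\<cdot>\<close>;
  the value at \<open>(1,0,-1)\<close> says that they agree when the left factor is a \<open>\<cdot>\<close>-product.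
\<close>

lemma ppp_Lie_2_defect_constants:
  "RA.ppp_Lie_2_defect mulp lhp [:a:] [:b:] [:c:] = quadratic
    ((a \<cdot> (c \<searrow> b) + (c \<searrow> b) \<cdot> a)
      - (a \<cdot> (c \<nwarrow> b) + (c \<nwarrow> b) \<cdot> a))
    (((c \<cdot> a) \<nwarrow> b + b \<searrow> (c \<cdot> a))
      - (b \<nwarrow> (c \<cdot> a) + (c \<cdot> a) \<searrow> b))
    (((c \<searrow> b) \<cdot> a + (c \<cdot> a) \<nwarrow> b)
      - ((c \<nwarrow> b) \<cdot> a + (c \<cdot> a) \<searrow> b))
    ((a \<cdot> (b \<searrow> c) + (b \<searrow> c) \<cdot> a + b \<nwarrow> (a \<cdot> c) + (a \<cdot> c) \<searrow> b)
      - (a \<cdot> (b \<nwarrow> c) + (b \<nwarrow> c) \<cdot> a + (a \<cdot> c) \<nwarrow> b + b \<searrow> (a \<cdot> c)))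
    (((a \<cdot> c) \<searrow> b) - ((a \<cdot> c) \<nwarrow> b))
    (((b \<searrow> c) \<cdot> a) - ((b \<nwarrow> c) \<cdot> a))"
  unfolding RA.ppp_Lie_2_defect_def
  by (simp add: expand)

lemma ppp_Lie_3_defect_constants:
  "RA.ppp_Lie_3_defect mulp lhp rhp [:a:] [:b:] [:c:] = quadratic
    ((a \<swarrow> (c \<cdot> b) + a \<searrow> (c \<cdot> b) + (c \<cdot> b) \<nwarrow> a + (c \<cdot> b) \<nearrow> a)
      - ((a \<nwarrow> b + a \<swarrow> b) \<cdot> c + c \<cdot> (a \<nwarrow> b + a \<swarrow> b)))
    (((b \<nearrow> a + b \<searrow> a) \<cdot> c + c \<cdot> (b \<nearrow> a + b \<searrow> a))
      - (b \<cdot> (c \<nearrow> a + c \<nwarrow> a) + (c \<nearrow> a + c \<nwarrow> a) \<cdot> b))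
    (((c \<cdot> b) \<nwarrow> a + (c \<cdot> b) \<nearrow> a)
      - ((c \<nwarrow> a + c \<nearrow> a) \<cdot> b))
    ((b \<cdot> (a \<searrow> c) + b \<cdot> (a \<swarrow> c) + (a \<searrow> c) \<cdot> b + (a \<swarrow> c) \<cdot> b)
      - ((b \<cdot> c) \<nearrow> a + (b \<cdot> c) \<nwarrow> a + a \<searrow> (b \<cdot> c) + a \<swarrow> (b \<cdot> c)))
    (((a \<swarrow> c + a \<searrow> c) \<cdot> b) - ((a \<nwarrow> b + a \<swarrow> b) \<cdot> c))
    (((b \<nearrow> a) \<cdot> c + (b \<searrow> a) \<cdot> c)
      - ((b \<cdot> c) \<nearrow> a + (b \<cdot> c) \<nwarrow> a))"
  unfolding RA.ppp_Lie_3_defect_def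
  by (simp add: expand)

text \<open>
  Exchanging \<open>a\<close> with \<open>b\<close> and \<open>\<lambda>\<close> with \<open>\<mu>\<close> changes the sign of this defect. Hence the values at \<open>(0,1,0)\<close> and
  \<open>(0,1,-1)\<close> are up to sign those at \<open>(1,0,0)\<close> and \<open>(1,0,-1)\<close> with \<open>a\<close> and \<open>b\<close> exchanged.
\<close>

lemma ppp_Lie_4_defect_constants:
  "RA.ppp_Lie_4_defect mulp lhp rhp [:a:] [:b:] [:c:] = quadratic
    ((a \<cdot> (c \<searrow> b) + (c \<searrow> b) \<cdot> a + c \<nearrow> (star a b) + (a \<cdot> b) \<nwarrow> c
        + c \<searrow> (a \<cdot> b) + (star a b) \<swarrow> c)
      - ((c \<nearrow> b) \<nearrow> a + a \<swarrow> (c \<nearrow> b)))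
    (((c \<nearrow> a) \<nearrow> b + b \<swarrow> (c \<nearrow> a))
      - (b \<cdot> (c \<searrow> a) + (c \<searrow> a) \<cdot> b + c \<nearrow> (star b a) + (b \<cdot> a) \<nwarrow> c
        + c \<searrow> (b \<cdot> a) + (star b a) \<swarrow> c))
    (((c \<nearrow> a) \<nearrow> b + (c \<searrow> b) \<cdot> a)
      - ((c \<nearrow> b) \<nearrow> a + (c \<searrow> a) \<cdot> b))
    ((a \<swarrow> (b \<swarrow> c) + (b \<swarrow> c) \<nearrow> a + b \<cdot> (a \<nwarrow> c) + (a \<nwarrow> c) \<cdot> b)
      - (b \<swarrow> (a \<swarrow> c) + (a \<swarrow> c) \<nearrow> b + a \<cdot> (b \<nwarrow> c) + (b \<nwarrow> c) \<cdot> a))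
    (((a \<nwarrow> c) \<cdot> b + (a \<cdot> b) \<nwarrow> c + (star a b) \<swarrow> c)
      - ((a \<swarrow> c) \<nearrow> b))
    (((b \<swarrow> c) \<nearrow> a)
      - ((b \<nwarrow> c) \<cdot> a + (b \<cdot> a) \<nwarrow> c + (star b a) \<swarrow> c))"
  unfolding RA.ppp_Lie_4_defect_def curly_def
  by (simp add: expand)

lemma ppp_Lie_5_defect_constants:
  "RA.ppp_Lie_5_defect mulp lhp rhp [:a:] [:b:] [:c:] = quadratic
    ((c \<searrow> (a \<swarrow> b + a \<searrow> b) + (a \<swarrow> b + a \<searrow> b) \<nwarrow> c)
      - (a \<swarrow> (c \<searrow> b) + (c \<searrow> b) \<nearrow> a + a \<cdot> (c \<searrow> b) + (c \<searrow> b) \<cdot> a))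
    (((c \<nearrow> a + c \<searrow> a) \<searrow> b + b \<nwarrow> (c \<nearrow> a + c \<searrow> a))
      - (c \<searrow> (b \<nearrow> a + b \<nwarrow> a) + (b \<nearrow> a + b \<nwarrow> a) \<nwarrow> c))
    (((c \<nearrow> a + c \<searrow> a) \<searrow> b)
      - ((c \<searrow> b) \<nearrow> a + (c \<searrow> b) \<cdot> a))
    ((a \<cdot> (b \<nwarrow> c) + (b \<nwarrow> c) \<cdot> a + a \<swarrow> (b \<nwarrow> c) + (b \<nwarrow> c) \<nearrow> a)
      - ((a \<nwarrow> c + a \<swarrow> c) \<searrow> b + b \<nwarrow> (a \<nwarrow> c + a \<swarrow> c)))
    (((a \<swarrow> b + a \<searrow> b) \<nwarrow> c) - ((a \<nwarrow> c + a \<swarrow> c) \<searrow> b))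
    (((b \<nwarrow> c) \<nearrow> a + (b \<nwarrow> c) \<cdot> a)
      - ((b \<nwarrow> a + b \<nearrow> a) \<nwarrow> c))"
  unfolding RA.ppp_Lie_5_defect_def
  by (simp add: expand)

end

section \<open>Comparison with the identities of Novikov type\<close>

context five_products
begin

lemma skew_defect_RA_product_constants:
  assumes f: "bilinear_map scale scale f" and g: "bilinear_map scale scale g"
  shows "RA.skew_defect (RA_product f g) [:a:] [:b:] =
    Lam (J ((f b a - g b a) - (f a b - g a b))) + Del (RA_act scale) (J (f b a - g b a))"
  unfolding RA.skew_defect_def
  by (simp add: prod_at_RA_product[OF f g] RA.operator_simps J_additive algebra_simps)

text \<open>
  The \<open>\<partial>\<close>-coefficient of the defect on \<open>A\<close> is \<open>f b a - g b a\<close>. If it vanishes for all \<open>a\<close> and \<open>b\<close>, so does the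
  \<open>\<lambda>\<close>-coefficient. For \<open>f = g = \<cdot>\<close>
  this is the skew symmetry of the bracket; for \<open>f = \<searrow>\<close>, \<open>g = \<nwarrow>\<close> it compares the two notions of being
  special.
\<close>

lemma skew_defect_RA_product_eq_0_iff:
  assumes f: "bilinear_map scale scale f" and g: "bilinear_map scale scale g"
  shows "(\<forall>u v. RA.skew_defect (RA_product f g) u v = 0) \<longleftrightarrow> (\<forall>a b. f a b = g a b)"
proof
  assume "\<forall>u v. RA.skew_defect (RA_product f g) u v = 0"
  then have "Lam (J ((f b a - g b a) - (f a b - g a b))) + Del (RA_act scale) (J (f b a - g b a)) = 0" for a b
    by (simp add: skew_defect_RA_product_constants[OF f g, symmetric])
  then show "\<forall>a b. f a b = g a b"
    by (simp add: Lam_def Del_def Const_def dd_RA_act map_poly_pCons)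
next
  assume "\<forall>a b. f a b = g a b"
  then have "RA.skew_defect (RA_product f g) [:a:] [:b:] = 0" for a b
    by (simp add: skew_defect_RA_product_constants[OF f g] Const_additive RA.operator_simps)
  then show "\<forall>u v. RA.skew_defect (RA_product f g) u v = 0"
    using skew_defect_vanishes[OF lambda_product_RA_product[OF f g]] by blast
qed

lemma Lie_conformal_iff_constants:
  "partial_pre_post_Lie_conformal_algebra (RA_act scale) mulp lhp rhp \<longleftrightarrow>
    (\<forall>a b c. RA.Jacobi_defect mulp [:a:] [:b:] [:c:] = 0 \<and>
      RA.ppp_Lie_1_defect mulp lhp [:a:] [:b:] [:c:] = 0 \<and>
      RA.ppp_Lie_2_defect mulp lhp [:a:] [:b:] [:c:] = 0 \<and>
      RA.ppp_Lie_3_defect mulp lhp rhp [:a:] [:b:] [:c:] = 0 \<and>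
      RA.ppp_Lie_4_defect mulp lhp rhp [:a:] [:b:] [:c:] = 0 \<and>
      RA.ppp_Lie_5_defect mulp lhp rhp [:a:] [:b:] [:c:] = 0)" (is "?L \<longleftrightarrow> ?R")
proof
  assume ?L
  then interpret L: partial_pre_post_Lie_conformal_algebra "RA_act scale" mulp lhp rhp .
  show ?R
    unfolding RA.Jacobi_defect_def RA.ppp_Lie_1_defect_def RA.ppp_Lie_2_defect_def RA.ppp_Lie_3_defect_def RA.ppp_Lie_4_defect_def
      RA.ppp_Lie_5_defect_def right_minus_eq
    using L.Jacobi L.ppp_Lie_1 L.ppp_Lie_2 L.ppp_Lie_3 L.ppp_Lie_4 L.ppp_Lie_5 by blast
next
  assume R: ?R
  note van = RA.conformal_trilinear_defects[OF mulp lhp rhp, THEN conformal_trilinear_vanishes]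
  have zero: "RA.Jacobi_defect mulp u v w = 0" "RA.ppp_Lie_1_defect mulp lhp u v w = 0"
    "RA.ppp_Lie_2_defect mulp lhp u v w = 0" "RA.ppp_Lie_3_defect mulp lhp rhp u v w = 0"
    "RA.ppp_Lie_4_defect mulp lhp rhp u v w = 0" "RA.ppp_Lie_5_defect mulp lhp rhp u v w = 0" for u v w
    by (rule van; use R in blast)+
  \<comment> \<open>both operations that define the bracket are \<open>\<cdot>\<close>\<close>
  have skew: "RA.skew_defect mulp u v = 0" for u v
    using skew_defect_RA_product_eq_0_iff[OF mul mul] by blast
  show ?L
    by unfold_locales
       (fact mulp lhp rhp
         skew[unfolded RA.skew_defect_def right_minus_eq]
         zero[unfolded RA.Jacobi_defect_def RA.ppp_Lie_1_defect_def RA.ppp_Lie_2_defect_def RA.ppp_Lie_3_defect_def RA.ppp_Lie_4_defect_def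
           RA.ppp_Lie_5_defect_def right_minus_eq])+
qed

text \<open>
  Modulo the agreement of \<open>\<nwarrow>\<close> and \<open>\<searrow>\<close> inside a \<open>\<cdot>\<close>-product, and of \<open>x \<nwarrow> y\<close> and \<open>x \<searrow> y\<close> when \<open>x\<close> or \<open>y\<close> is a
  \<open>\<cdot>\<close>-product, each value of the defects vanishes by a single identity. The exceptions are left symmetry in the Jacobi
  defect, which is rearranged by right commutativity, and the value of \<open>ppp_Lie_4_defect\<close> at \<open>(1,0,0)\<close>, which is
  a combination of \<open>ppp_Nov_10\<close> and \<open>ppp_Nov_12\<close>.
\<close>

lemma Novikov_imp_constants:
  assumes "partial_pre_post_Novikov_algebra scale mul ne se nw sw"
  shows "RA.Jacobi_defect mulp [:a:] [:b:] [:c:] = 0" "RA.ppp_Lie_1_defect mulp lhp [:a:] [:b:] [:c:] = 0"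
    "RA.ppp_Lie_2_defect mulp lhp [:a:] [:b:] [:c:] = 0" "RA.ppp_Lie_3_defect mulp lhp rhp [:a:] [:b:] [:c:] = 0"
    "RA.ppp_Lie_4_defect mulp lhp rhp [:a:] [:b:] [:c:] = 0" "RA.ppp_Lie_5_defect mulp lhp rhp [:a:] [:b:] [:c:] = 0"
proof -
  interpret N: partial_pre_post_Novikov_algebra scale mul ne se nw sw by fact
  have nw_se_mul: "(x \<nwarrow> y) \<cdot> z = (x \<searrow> y) \<cdot> z" "z \<cdot> (x \<nwarrow> y) = z \<cdot> (x \<searrow> y)" for x y z
    using N.ppp_Nov_7_left[of x y z] N.ppp_Nov_7_right[of z x y] by (simp_all add: products_additive)
  have mul_se: "(x \<cdot> y) \<searrow> z = (x \<cdot> y) \<nwarrow> z" for x y z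
    using N.ppp_Nov_4_left N.ppp_Nov_4_right by simp
  \<comment> \<open>left symmetry with \<open>(x \<cdot> z) \<cdot> y\<close> and \<open>(z \<cdot> x) \<cdot> y\<close> rearranged by right commutativity\<close>
  have LS: "x \<cdot> (z \<cdot> y) + (z \<cdot> y) \<cdot> x = z \<cdot> (x \<cdot> y) + (x \<cdot> y) \<cdot> z" for x y z
    using N.left_symmetry[of x z y] N.right_commutativity[of x z y] N.right_commutativity[of z x y]
    by (simp add: algebra_simps)
  have se_mul: "x \<nwarrow> (z \<cdot> y) = x \<searrow> (z \<cdot> y)" for x y z
    using N.ppp_Nov_3[of z y x] N.ppp_Nov_6[of x z y] by (simp add: mul_se) (metis add.commute add_left_cancel)
  show "RA.Jacobi_defect mulp [:a:] [:b:] [:c:] = 0"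
    unfolding Jacobi_defect_constants quadratic_eq_0_iff right_minus_eq
    using LS N.right_commutativity by blast
  show "RA.ppp_Lie_1_defect mulp lhp [:a:] [:b:] [:c:] = 0"
    unfolding ppp_Lie_1_defect_constants quadratic_eq_0_iff right_minus_eq
    by (intro conjI N.ppp_Nov_3 N.ppp_Nov_6[symmetric] N.ppp_Nov_3[symmetric] N.ppp_Nov_4_right[symmetric] N.ppp_Nov_4_right N.ppp_Nov_4_left)
  show "RA.ppp_Lie_2_defect mulp lhp [:a:] [:b:] [:c:] = 0"
    unfolding ppp_Lie_2_defect_constants quadratic_eq_0_iff right_minus_eq
    by (simp add: nw_se_mul mul_se se_mul algebra_simps)
  show "RA.ppp_Lie_3_defect mulp lhp rhp [:a:] [:b:] [:c:] = 0"
    unfolding ppp_Lie_3_defect_constants quadratic_eq_0_iff right_minus_eq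
    using N.ppp_Nov_5[of a b c] N.ppp_Nov_2[of b c a] N.ppp_Nov_1[of c a b] N.ppp_Nov_5[of a c b]
      N.ppp_Nov_8[of a c b] N.ppp_Nov_1[of b a c]
    by (simp add: nw_se_mul products_additive algebra_simps)
  have N12: "(x \<swarrow> z) \<nearrow> y = (x \<nwarrow> z) \<cdot> y + (x \<cdot> y) \<nwarrow> z + star x y \<swarrow> z" for x y z
    using N.ppp_Nov_12[of x y z] by (simp add: nw_se_mul mul_se ac_simps)
  have N10: "x \<cdot> (z \<searrow> y) + (z \<searrow> y) \<cdot> x + z \<nearrow> star x y + (x \<cdot> y) \<nwarrow> z + z \<searrow> (x \<cdot> y) + star x y \<swarrow> z =
      (z \<nearrow> y) \<nearrow> x + x \<swarrow> (z \<nearrow> y)" for x y z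
    using N.ppp_Nov_10[of x z y] by (simp add: N12 nw_se_mul se_mul ac_simps)
  show "RA.ppp_Lie_4_defect mulp lhp rhp [:a:] [:b:] [:c:] = 0"
    unfolding ppp_Lie_4_defect_constants quadratic_eq_0_iff right_minus_eq
    using N.ppp_Nov_18[of c a b] N.ppp_Nov_15[of a b c]
    by (intro conjI N10 N10[symmetric] N12 N12[symmetric])
  show "RA.ppp_Lie_5_defect mulp lhp rhp [:a:] [:b:] [:c:] = 0"
    unfolding ppp_Lie_5_defect_constants quadratic_eq_0_iff right_minus_eq
    using N.ppp_Nov_13[of a c b] N.ppp_Nov_17[of c a b] N.ppp_Nov_14[of c a b] N.ppp_Nov_9[of a c b]
      N.ppp_Nov_16[of a c b] N.ppp_Nov_11[of b a c]
    by simp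
qed

text \<open>
  The values of \<open>ppp_Lie_2_defect\<close> give the agreement of \<open>\<nwarrow>\<close> and \<open>\<searrow>\<close> in the presence of \<open>\<cdot>\<close>. Modulo this agreement the
  other identities are read off from single values, except that left symmetry needs right commutativity and
  that \<open>ppp_Nov_10\<close> needs \<open>ppp_Nov_12\<close>.
\<close>

lemma constants_imp_Novikov:
  assumes "\<And>a b c. RA.Jacobi_defect mulp [:a:] [:b:] [:c:] = 0"
    and "\<And>a b c. RA.ppp_Lie_1_defect mulp lhp [:a:] [:b:] [:c:] = 0"
    and "\<And>a b c. RA.ppp_Lie_2_defect mulp lhp [:a:] [:b:] [:c:] = 0"
    and "\<And>a b c. RA.ppp_Lie_3_defect mulp lhp rhp [:a:] [:b:] [:c:] = 0"
    and "\<And>a b c. RA.ppp_Lie_4_defect mulp lhp rhp [:a:] [:b:] [:c:] = 0"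
    and "\<And>a b c. RA.ppp_Lie_5_defect mulp lhp rhp [:a:] [:b:] [:c:] = 0"
  shows "partial_pre_post_Novikov_algebra scale mul ne se nw sw"
proof -
  note J = assms(1)[unfolded Jacobi_defect_constants quadratic_eq_0_iff right_minus_eq]
  note d1 = assms(2)[unfolded ppp_Lie_1_defect_constants quadratic_eq_0_iff right_minus_eq]
  note d2 = assms(3)[unfolded ppp_Lie_2_defect_constants quadratic_eq_0_iff right_minus_eq]
  note d3 = assms(4)[unfolded ppp_Lie_3_defect_constants quadratic_eq_0_iff right_minus_eq]
  note d4 = assms(5)[unfolded ppp_Lie_4_defect_constants quadratic_eq_0_iff right_minus_eq]
  note d5 = assms(6)[unfolded ppp_Lie_5_defect_constants quadratic_eq_0_iff right_minus_eq]
  have RC: "(x \<cdot> y) \<cdot> z = (x \<cdot> z) \<cdot> y" for x y z using J by blast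
  have mul_se: "(x \<cdot> y) \<searrow> z = (x \<cdot> y) \<nwarrow> z" for x y z using d2 by blast
  have nw_comm: "(x \<cdot> y) \<nwarrow> z = (x \<cdot> z) \<nwarrow> y" for x y z using d1 by blast
  have nw_se_left: "(x \<nwarrow> y) \<cdot> z = (x \<searrow> y) \<cdot> z" for x y z
    using d2[where a=z and b=x and c=y] by simp
  have nw_se_right: "z \<cdot> (x \<nwarrow> y) = z \<cdot> (x \<searrow> y)" for x y z
    using d2[where a=z and b=y and c=x] by (simp add: nw_se_left)
  have se_mul: "x \<nwarrow> (z \<cdot> y) = x \<searrow> (z \<cdot> y)" for x y z
    using d2[where a=y and b=x and c=z] by (simp add: mul_se)
  note [simp] = nw_se_left nw_se_right mul_se se_mul
  have N12: "star a b \<swarrow> c + (a \<searrow> c) \<cdot> b + (a \<cdot> b) \<searrow> c = (a \<swarrow> c) \<nearrow> b" for a b c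
    using d4[where a=a and b=b and c=c] by (simp add: algebra_simps)
  show ?thesis
  proof
    fix a b c
    show "(a \<cdot> b) \<cdot> c - a \<cdot> (b \<cdot> c) = (b \<cdot> a) \<cdot> c - b \<cdot> (a \<cdot> c)"
      using J[where a=a and b=c and c=b] RC[of a b c] RC[of b a c] by (simp add: algebra_simps)
    show "(a \<cdot> b) \<cdot> c = (a \<cdot> c) \<cdot> b" by (rule RC)
    show "(c \<nwarrow> b + c \<nearrow> b) \<cdot> a = (c \<cdot> a) \<nwarrow> b + (c \<cdot> a) \<nearrow> b"
      using d3[where a=b and b=a and c=c] by metis
    show "a \<cdot> (c \<nearrow> b + c \<nwarrow> b) + (c \<nearrow> b + c \<nwarrow> b) \<cdot> a =
      (a \<nearrow> b + a \<searrow> b) \<cdot> c + c \<cdot> (a \<nearrow> b + a \<searrow> b)"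
      using d3[where a=b and b=a and c=c] by metis
    show "(a \<cdot> b) \<searrow> c + c \<nwarrow> (a \<cdot> b) = a \<searrow> (c \<cdot> b) + (c \<cdot> b) \<nwarrow> a"
      using d1[where a=c and b=b and c=a] by metis
    show "(c \<cdot> b) \<nwarrow> a = (c \<cdot> a) \<nwarrow> b" by (rule nw_comm)
    show "(c \<cdot> a) \<nwarrow> b = (c \<cdot> b) \<searrow> a" using nw_comm by simp
    show "(a \<nwarrow> b + a \<swarrow> b) \<cdot> c + c \<cdot> (a \<nwarrow> b + a \<swarrow> b) =
      a \<swarrow> (c \<cdot> b) + a \<searrow> (c \<cdot> b) + (c \<cdot> b) \<nwarrow> a + (c \<cdot> b) \<nearrow> a"
      using d3[where a=a and b=b and c=c] by metis
    show "a \<searrow> (b \<cdot> c) + (b \<cdot> c) \<nwarrow> a = b \<searrow> (a \<cdot> c) + (a \<cdot> c) \<nwarrow> b"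
      using d1[where a=c and b=b and c=a] by metis
    show "(a \<nwarrow> b - a \<searrow> b) \<cdot> c = c \<cdot> (a \<searrow> b - a \<nwarrow> b)"
      "c \<cdot> (a \<searrow> b - a \<nwarrow> b) = 0"
      by (simp_all add: products_additive)
    show "(a \<swarrow> c + a \<searrow> c) \<cdot> b = (a \<nwarrow> b + a \<swarrow> b) \<cdot> c"
      using d3[where a=a and b=b and c=c] by metis
    show "(a \<nwarrow> b + a \<swarrow> b) \<searrow> c + c \<nwarrow> (a \<nwarrow> b + a \<swarrow> b) =
      a \<cdot> (c \<nwarrow> b) + (c \<nwarrow> b) \<cdot> a + a \<swarrow> (c \<nwarrow> b) + (c \<nwarrow> b) \<nearrow> a"
      using d5[where a=a and b=c and c=b] by metis
    show "a \<swarrow> (c \<nearrow> b) + (c \<nearrow> b) \<nearrow> a + (a \<searrow> c) \<cdot> b =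
      c \<nearrow> star a b + c \<nwarrow> (a \<cdot> b) + a \<cdot> (c \<nwarrow> b) + (c \<nwarrow> b) \<cdot> a + (a \<swarrow> c) \<nearrow> b"
      using d4[where a=a and b=b and c=c] by (simp add: N12[symmetric] ac_simps)
    show "(a \<nwarrow> b + a \<nearrow> b) \<nwarrow> c = (a \<nwarrow> c) \<nearrow> b + (a \<nwarrow> c) \<cdot> b"
      using d5[where a=b and b=a and c=c] by metis
    show "star a b \<swarrow> c + (a \<searrow> c) \<cdot> b + (a \<cdot> b) \<searrow> c = (a \<swarrow> c) \<nearrow> b" by (rule N12)
    show "a \<swarrow> (c \<searrow> b) + (c \<searrow> b) \<nearrow> a + a \<cdot> (c \<searrow> b) + (c \<searrow> b) \<cdot> a =
      c \<searrow> (a \<swarrow> b + a \<searrow> b) + (a \<swarrow> b + a \<searrow> b) \<nwarrow> c"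
      using d5[where a=a and b=b and c=c] by metis
    show "(c \<nearrow> a + c \<searrow> a) \<searrow> b = (c \<searrow> b) \<nearrow> a + (c \<searrow> b) \<cdot> a"
      using d5[where a=a and b=b and c=c] by metis
    show "a \<swarrow> (b \<swarrow> c) + (b \<swarrow> c) \<nearrow> a + b \<cdot> (a \<nwarrow> c) + (a \<nwarrow> c) \<cdot> b =
      b \<swarrow> (a \<swarrow> c) + (a \<swarrow> c) \<nearrow> b + a \<cdot> (b \<nwarrow> c) + (b \<nwarrow> c) \<cdot> a"
      using d4[where a=a and b=b and c=c] by metis
    show "(a \<nwarrow> b + a \<swarrow> b) \<searrow> c = (a \<swarrow> c + a \<searrow> c) \<nwarrow> b"
      using d5[where a=a and b=c and c=b] by metis
    show "(a \<nearrow> b + a \<searrow> b) \<searrow> c + c \<nwarrow> (a \<nearrow> b + a \<searrow> b) =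
      a \<searrow> (c \<nearrow> b + c \<nwarrow> b) + (c \<nearrow> b + c \<nwarrow> b) \<nwarrow> a"
      using d5[where a=b and b=c and c=a] by metis
    show "(a \<nearrow> b) \<nearrow> c + (a \<searrow> c) \<cdot> b = (a \<nearrow> c) \<nearrow> b + (a \<searrow> b) \<cdot> c"
      using d4[where a=b and b=c and c=a] by metis
  qed (fact mul ne se nw sw)+
qed

lemma Lie_conformal_iff_Novikov:
  "partial_pre_post_Lie_conformal_algebra (RA_act scale) mulp lhp rhp \<longleftrightarrow>
    partial_pre_post_Novikov_algebra scale mul ne se nw sw"
  unfolding Lie_conformal_iff_constants
  using Novikov_imp_constants constants_imp_Novikov by blast

lemma special_Lie_conformal_iff_special_Novikov:
  "special_partial_pre_post_Lie_conformal_algebra (RA_act scale) mulp lhp rhp \<longleftrightarrow>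
    special_partial_pre_post_Novikov_algebra scale mul ne se nw sw"
  unfolding special_partial_pre_post_Lie_conformal_algebra_def
    special_partial_pre_post_Lie_conformal_algebra_axioms_def
    special_partial_pre_post_Novikov_algebra_def special_partial_pre_post_Novikov_algebra_axioms_def
  using skew_defect_RA_product_eq_0_iff[OF se nw, unfolded RA.skew_defect_def right_minus_eq]
  by (simp add: Lie_conformal_iff_Novikov)

end

theorem proposition4p24:
  fixes scale :: "'k::field_char_0 \<Rightarrow> 'a::ab_group_add \<Rightarrow> 'a"
    and Basis :: "'a set"
    and mul ne se nw sw :: "'a \<Rightarrow> 'a \<Rightarrow> 'a"
  assumes "finite_dimensional_vector_space scale Basis"
    and "bilinear_map scale scale mul"
    and "bilinear_map scale scale ne"
    and "bilinear_map scale scale se"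
    and "bilinear_map scale scale nw"
    and "bilinear_map scale scale sw"
  shows "(partial_pre_post_Lie_conformal_algebra (RA_act scale)
            (RA_product mul mul) (RA_product se nw) (RA_product ne sw)
          \<longleftrightarrow> partial_pre_post_Novikov_algebra scale mul ne se nw sw)
       \<and> (special_partial_pre_post_Lie_conformal_algebra (RA_act scale)
            (RA_product mul mul) (RA_product se nw) (RA_product ne sw)
          \<longleftrightarrow> special_partial_pre_post_Novikov_algebra scale mul ne se nw sw)"
proof -
  interpret finite_dimensional_vector_space scale Basis by fact
  interpret five_products scale mul ne se nw sw
    by unfold_locales (fact assms)+
  show ?thesis
    using Lie_conformal_iff_Novikov special_Lie_conformal_iff_special_Novikov by blast
qed

end
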